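(* Let $m,d\ge 1$ be fixed. (i) There is no pure Minkowski $(k,\ell)$-neighborly family $P_{[m]}$ of polytopes in $\mathbb{R}^d$ with $k+\ell-1>\frac{d+\ell-1}{2}$. (ii) For all $\mathbf{n}\in\mathbb{Z}^m_{\ge d+1}$ there is a family $P_{[m]}$ of polytopes in $\mathbb{R}^d$ with $f_0(P_i)=n_i$ for all $i$ that is Minkowski $(k,\ell)$-neighborly for all $\ell\le m$ and all $k$ with $\ell-1\le k+\ell-1\le\lfloor\frac{d+\ell-1}{2}\rfloor$.
   Context: A family $P_{[m]}=(P_1,\dots,P_m)$ of polytopes in $\mathbb{R}^d$ is pure if $f_0(P_i)\ge d+1$ for all $i$ ($f_0$ = number of vertices). For $J\subseteq[m]$ write $|P_J|=\sum_{j\in J}P_j$ (Minkowski sum). The family is Minkowski $(k,\ell)$-neighborly ($k\ge0$) if for every $J\subseteq[m]$ with $|J|=\ell$ and every choice of nonempty vertex sets $S_j\subseteq\mathrm{vert}(P_j)$, $j\in J$, with $\sum_{j\in J}|S_j|\le k+|J|-1$, the polytope $\sum_{j\in J}\mathrm{conv}(S_j)$ is a face of $|P_J|$ that is a simplex.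
   Formalization: For l≥2 the face Σconv(S_j) is asked to come from a simplex of the Cayley polytope (conv(S_j) simplices, dimensions adding), not to be a simplex; (i) takes 1≤l≤m, k≥1 and excludes l=1 with all P_i d-simplices; (ii) for d=1 takes all n_i=2. Otherwise the claim fails. *)

theory Defs
  imports "HOL-Analysis.Analysis"
begin

text \<open>
  A family \<open>P\<^sub>1, \<dots>, P\<^sub>m\<close> of polytopes in \<open>d\<close>-dimensional space is a function
  \<open>P :: 'm \<Rightarrow> (real^'d) set\<close>, with \<open>m = CARD('m)\<close> and \<open>d = CARD('d)\<close>; both are at least 1 since
  types are nonempty. Minkowski sums are the set sums of \<^theory>\<open>HOL-Library.Set_Algebras\<close>; the
  empty one is \<open>{0}\<close>.
\<close>

definition verts :: "'a::real_vector set \<Rightarrow> 'a set" where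
  "verts P = {v. v extreme_point_of P}"

definition f0 :: "'a::real_vector set \<Rightarrow> nat" where
  "f0 P = card (verts P)"

definition pure_family :: "('m::finite \<Rightarrow> (real^'d::finite) set) \<Rightarrow> bool" where
  "pure_family P \<longleftrightarrow> (\<forall>i. CARD('d) + 1 \<le> f0 (P i))"

definition cayley :: "'m set \<Rightarrow> ('m::finite \<Rightarrow> (real^'d::finite) set) \<Rightarrow> ((real^'d) \<times> (real^'m)) set" where
  "cayley J Q = convex hull (\<Union>j\<in>J. Q j \<times> {axis j 1})"

text \<open>
  A face \<open>\<Sum>j\<in>J. conv (S\<^sub>j)\<close> of a Minkowski sum is called a simplex if the face of the Cayley
  polytope that it corresponds to, the convex hull of all \<open>S\<^sub>j \<times> {e\<^sub>j}\<close>, is a simplex with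
  \<open>\<Sum>j\<in>J. card (S\<^sub>j)\<close> vertices, i.e. if every \<open>conv (S\<^sub>j)\<close> is a simplex and the dimensions of these
  simplices add up. The set \<open>\<Sum>j\<in>J. conv (S\<^sub>j)\<close> itself is then a product of simplices. It could
  not be required to be a simplex: two nonparallel edges sum to a parallelogram. For \<open>card J = 1\<close>
  the two readings coincide.
\<close>

definition minkowski_neighborly ::
    "nat \<Rightarrow> nat \<Rightarrow> ('m::finite \<Rightarrow> (real^'d::finite) set) \<Rightarrow> bool" where
  "minkowski_neighborly k l P \<longleftrightarrow>
     (\<forall>J S. card J = l \<longrightarrow>
        (\<forall>j\<in>J. S j \<noteq> {} \<and> S j \<subseteq> verts (P j)) \<longrightarrow>
        int (\<Sum>j\<in>J. card (S j)) \<le> int k + int (card J) - 1 \<longrightarrow>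
        (\<Sum>j\<in>J. convex hull (S j)) face_of (\<Sum>j\<in>J. P j) \<and>
        (int (\<Sum>j\<in>J. card (S j)) - 1) simplex (cayley J S))"

end

theory Submission
  imports Defs
begin

text \<open>
  Nonexistence: choose \<open>J\<^sub>0 \<subseteq> J\<close> of size \<open>min l (d + 1)\<close> and \<open>d + 1 + card J\<^sub>0\<close> vertices, at least
  two from each \<open>P\<^sub>j\<close> with \<open>j \<in> J\<^sub>0\<close>. Their Cayley points are linearly dependent. The positive or the
  negative part of a dependency, completed by single vertices where it vanishes, is small enough to
  span a face. A functional exposing that face is also maximal on the other part, which is
  impossible. If \<open>l = 1\<close>, there may be only \<open>d + 1\<close> vertices, but they are then affinely dependent.

  Existence: put the vertices of \<open>P\<^sub>j\<close> on the curve \<open>t \<mapsto> \<Sum>\<^sub>i (\<epsilon> t)\<^sup>i \<phi>(x\<^sub>j\<^sub>i)\<close>, where \<open>\<phi>\<close> is the moment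
  curve, so that linear functionals become polynomials \<open>q\<close> of degree less than \<open>d\<close>. As \<open>\<epsilon>\<close> tends to
  0, the values \<open>q (x\<^sub>j\<^sub>i)\<close> with \<open>i < 2 s\<^sub>j\<close>, \<open>s\<^sub>j = card (S\<^sub>j)\<close>, can be prescribed independently, and
  those with \<open>i = 2 s\<^sub>j\<close> take over as leading coefficients. The nodes are placed such that the
  polynomial vanishing at all \<open>x\<^sub>j\<^sub>i\<close> with \<open>i < 2 s\<^sub>j\<close> is positive at all \<open>x\<^sub>j\<^sub>i\<close> with \<open>i = 2 s\<^sub>j\<close>, as in
  Gale's evenness condition. Hence some functional behaves on \<open>P\<^sub>j\<close> like \<open>- \<Prod>\<^sub>s (t - s)\<^sup>2\<close>, \<open>s \<in> S\<^sub>j\<close>,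
  up to a constant. This is carried out on the dual side: dependencies that would prevent the face,
  rescaled by \<open>\<epsilon>\<close> to the power \<open>2 s\<^sub>j\<close> in block \<open>j\<close>, have a limit that cannot exist.
\<close>

subsection \<open>Faces of Minkowski sums via signed dependencies\<close>

text \<open>
  Dependencies that are nonnegative off \<open>S\<close>: the Farkas dual of a functional that, on each block
  \<open>j \<in> J\<close>, is maximal exactly at \<open>S j\<close>, together with affine independence of the Cayley points of \<open>S\<close>.
\<close>

definition no_dependency :: "'m set \<Rightarrow> ('m \<Rightarrow> 'i set) \<Rightarrow> ('m \<Rightarrow> 'i set) \<Rightarrow> ('m \<Rightarrow> 'i \<Rightarrow> 'a::real_vector) \<Rightarrow> bool" where
  "no_dependency J T S v \<longleftrightarrow>
     (\<forall>w. (\<forall>j\<in>J. (\<Sum>t\<in>T j. w j t) = 0) \<longrightarrow> (\<forall>j\<in>J. \<forall>t\<in>T j - S j. (0::real) \<le> w j t) \<longrightarrow>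
        (\<Sum>j\<in>J. \<Sum>t\<in>T j. w j t *\<^sub>R v j t) = 0 \<longrightarrow> (\<forall>j\<in>J. \<forall>t\<in>T j. w j t = 0))"

lemma mem_sum_convex_hull_iff:
  fixes X :: "'m \<Rightarrow> 'a::real_vector set"
  assumes "finite J" "\<forall>j\<in>J. finite (X j)"
  shows "y \<in> (\<Sum>j\<in>J. convex hull (X j)) \<longleftrightarrow>
    (\<exists>u. (\<forall>j\<in>J. (\<forall>x\<in>X j. 0 \<le> u j x) \<and> sum (u j) (X j) = 1) \<and> y = (\<Sum>j\<in>J. \<Sum>x\<in>X j. u j x *\<^sub>R x))"
    (is "?l \<longleftrightarrow> ?r")
proof
  assume ?l
  then obtain f where f: "y = sum f J" "\<forall>j\<in>J. f j \<in> convex hull (X j)"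
    unfolding set_sum_alt[OF assms(1)] by auto
  have "\<forall>j\<in>J. \<exists>u. (\<forall>x\<in>X j. 0 \<le> u x) \<and> sum u (X j) = 1 \<and> (\<Sum>x\<in>X j. u x *\<^sub>R x) = f j"
    using f(2) assms(2) by (simp add: convex_hull_finite)
  then obtain u where "\<forall>j\<in>J. (\<forall>x\<in>X j. 0 \<le> u j x) \<and> sum (u j) (X j) = 1 \<and> (\<Sum>x\<in>X j. u j x *\<^sub>R x) = f j"
    by metis
  then show ?r using f(1) by (intro exI[of _ u]) auto
next
  assume ?r
  then obtain u where u: "\<forall>j\<in>J. (\<forall>x\<in>X j. 0 \<le> u j x) \<and> sum (u j) (X j) = 1"
    "y = (\<Sum>j\<in>J. \<Sum>x\<in>X j. u j x *\<^sub>R x)" by blast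
  have "\<forall>j\<in>J. (\<Sum>x\<in>X j. u j x *\<^sub>R x) \<in> convex hull (X j)"
    using u(1) assms(2) by (auto simp: convex_hull_finite)
  then show ?l unfolding set_sum_alt[OF assms(1)] u(2) by blast
qed

text \<open>If a point \<open>y\<close> of the small sum lies strictly between \<open>a\<close> and
  \<open>b\<close>, the combined weights of \<open>a\<close> and \<open>b\<close> minus those of
  \<open>y\<close> form a dependency that is nonnegative off \<open>S\<close>. As it vanishes, the
  weights of \<open>a\<close> are concentrated on \<open>S\<close>.\<close>

lemma face_of_sum_convex_hull:
  fixes X S :: "'m \<Rightarrow> 'a::real_vector set"
  assumes J: "finite J" and X: "\<And>j. j \<in> J \<Longrightarrow> finite (X j)" and S: "\<And>j. j \<in> J \<Longrightarrow> S j \<subseteq> X j"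
    and nd: "no_dependency J X S (\<lambda>_ x. x)"
  shows "(\<Sum>j\<in>J. convex hull (S j)) face_of (\<Sum>j\<in>J. convex hull (X j))"
  unfolding face_of_def
proof (intro conjI ballI impI)
  have finX: "\<forall>j\<in>J. finite (X j)" using X by blast
  have finS: "\<forall>j\<in>J. finite (S j)" using X S finite_subset by blast
  show "(\<Sum>j\<in>J. convex hull (S j)) \<subseteq> (\<Sum>j\<in>J. convex hull (X j))"
    unfolding set_sum_alt[OF J] using hull_mono[OF S] by blast
  show "convex (\<Sum>j\<in>J. convex hull (S j))"
    by (simp flip: convex_hull_set_sum)
  have main: "a \<in> (\<Sum>j\<in>J. convex hull (S j))"
    if ab: "a \<in> (\<Sum>j\<in>J. convex hull (X j))" "b \<in> (\<Sum>j\<in>J. convex hull (X j))"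
      and y: "y \<in> (\<Sum>j\<in>J. convex hull (S j))" "y \<in> open_segment a b" for a b y
  proof -
    obtain \<alpha> where \<alpha>: "\<forall>j\<in>J. (\<forall>x\<in>X j. 0 \<le> \<alpha> j x) \<and> sum (\<alpha> j) (X j) = 1"
      "a = (\<Sum>j\<in>J. \<Sum>x\<in>X j. \<alpha> j x *\<^sub>R x)"
      using ab(1)[unfolded mem_sum_convex_hull_iff[OF J finX]] by (elim exE conjE)
    obtain \<beta> where \<beta>: "\<forall>j\<in>J. (\<forall>x\<in>X j. 0 \<le> \<beta> j x) \<and> sum (\<beta> j) (X j) = 1"
      "b = (\<Sum>j\<in>J. \<Sum>x\<in>X j. \<beta> j x *\<^sub>R x)"
      using ab(2)[unfolded mem_sum_convex_hull_iff[OF J finX]] by (elim exE conjE)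
    obtain \<sigma> where \<sigma>: "\<forall>j\<in>J. (\<forall>x\<in>S j. 0 \<le> \<sigma> j x) \<and> sum (\<sigma> j) (S j) = 1"
      "y = (\<Sum>j\<in>J. \<Sum>x\<in>S j. \<sigma> j x *\<^sub>R x)"
      using y(1)[unfolded mem_sum_convex_hull_iff[OF J finS]] by (elim exE conjE)
    obtain u where u: "0 < u" "u < 1" "y = (1 - u) *\<^sub>R a + u *\<^sub>R b"
      using y(2) by (auto simp: in_segment)
    define \<tau> where "\<tau> j x = (if x \<in> S j then \<sigma> j x else 0)" for j x
    have \<tau>: "sum (\<tau> j) (X j) = 1" "(\<Sum>x\<in>X j. \<tau> j x *\<^sub>R x) = (\<Sum>x\<in>S j. \<sigma> j x *\<^sub>R x)" if "j \<in> J" for j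
    proof -
      have "sum (\<tau> j) (X j) = sum (\<tau> j) (S j)"
        by (rule sum.mono_neutral_right) (use X S that in \<open>auto simp: \<tau>_def\<close>)
      then show "sum (\<tau> j) (X j) = 1" using \<sigma>(1) that by (simp add: \<tau>_def)
      have "(\<Sum>x\<in>X j. \<tau> j x *\<^sub>R x) = (\<Sum>x\<in>S j. \<tau> j x *\<^sub>R x)"
        by (rule sum.mono_neutral_right) (use X S that in \<open>auto simp: \<tau>_def\<close>)
      then show "(\<Sum>x\<in>X j. \<tau> j x *\<^sub>R x) = (\<Sum>x\<in>S j. \<sigma> j x *\<^sub>R x)" by (simp add: \<tau>_def)
    qed
    \<comment> \<open>Off \<open>S j\<close> the term \<open>\<tau> j x\<close> is zero, so only the
      nonnegative weights of \<open>a\<close> and \<open>b\<close> remain there.\<close>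
    define w where "w j x = (1 - u) * \<alpha> j x + u * \<beta> j x - \<tau> j x" for j x
    have "\<forall>j\<in>J. (\<Sum>x\<in>X j. w j x) = 0"
      unfolding w_def using \<alpha>(1) \<beta>(1) \<tau>(1)
      by (simp add: sum.distrib sum_subtractf flip: sum_distrib_left)
    moreover have "\<forall>j\<in>J. \<forall>x\<in>X j - S j. 0 \<le> w j x"
      unfolding w_def \<tau>_def using \<alpha>(1) \<beta>(1) u by auto
    moreover have "(\<Sum>j\<in>J. \<Sum>x\<in>X j. w j x *\<^sub>R x) = (1 - u) *\<^sub>R a + u *\<^sub>R b - y"
      unfolding w_def \<alpha>(2) \<beta>(2) \<sigma>(2)
      by (simp add: sum.distrib sum_subtractf scaleR_left_distrib scaleR_left_diff_distrib \<tau>(2) scaleR_sum_right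
          cong: sum.cong)
    ultimately have w0: "\<forall>j\<in>J. \<forall>x\<in>X j. w j x = 0"
      using nd u(3) unfolding no_dependency_def by simp
    have \<alpha>0: "\<alpha> j x = 0" if "j \<in> J" "x \<in> X j - S j" for j x
    proof -
      have "(1 - u) * \<alpha> j x + u * \<beta> j x = 0" using w0 that unfolding w_def \<tau>_def by auto
      moreover have "0 \<le> (1 - u) * \<alpha> j x" "0 \<le> u * \<beta> j x" using \<alpha>(1) \<beta>(1) that u by auto
      ultimately have "(1 - u) * \<alpha> j x = 0" by linarith
      then show ?thesis using u by simp
    qed
    have restrict: "sum (\<alpha> j) (X j) = sum (\<alpha> j) (S j)"
      "(\<Sum>x\<in>X j. \<alpha> j x *\<^sub>R x) = (\<Sum>x\<in>S j. \<alpha> j x *\<^sub>R x)" if "j \<in> J" for j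
      using \<alpha>0[OF that] by (intro sum.mono_neutral_right X[OF that] S[OF that]; simp)+
    show ?thesis
      unfolding mem_sum_convex_hull_iff[OF J finS]
    proof (intro exI[of _ \<alpha>] conjI ballI)
      show "0 \<le> \<alpha> j x" if "j \<in> J" "x \<in> S j" for j x
        using \<alpha>(1) S[OF that(1)] that by blast
      show "sum (\<alpha> j) (S j) = 1" if "j \<in> J" for j
        using \<alpha>(1) restrict(1)[OF that] that by simp
      show "a = (\<Sum>j\<in>J. \<Sum>x\<in>S j. \<alpha> j x *\<^sub>R x)"
        unfolding \<alpha>(2) by (intro sum.cong refl restrict)
    qed
  qed
  show "a \<in> (\<Sum>j\<in>J. convex hull (S j))" "b \<in> (\<Sum>j\<in>J. convex hull (S j))"
    if "a \<in> (\<Sum>j\<in>J. convex hull (X j))" "b \<in> (\<Sum>j\<in>J. convex hull (X j))"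
      "y \<in> (\<Sum>j\<in>J. convex hull (S j))" "y \<in> open_segment a b" for a b y
    using main that open_segment_commute by blast+
qed

section \<open>Cayley points and their dependencies\<close>

lemma sum_cayley_points:
  fixes S :: "'m::finite \<Rightarrow> (real^'d::finite) set"
  assumes "\<forall>j\<in>J. finite (S j)"
  shows "(\<Sum>p\<in>(\<Union>j\<in>J. S j \<times> {axis j (1::real)}). g p) = (\<Sum>j\<in>J. \<Sum>x\<in>S j. g (x, axis j 1))"
proof -
  have "(\<Sum>p\<in>(\<Union>j\<in>J. S j \<times> {axis j (1::real)}). g p) = (\<Sum>j\<in>J. \<Sum>p\<in>S j \<times> {axis j 1}. g p)"
    using assms by (intro sum.UNION_disjoint) (auto simp: axis_eq_axis)
  also have "\<dots> = (\<Sum>j\<in>J. \<Sum>x\<in>S j. g (x, axis j 1))"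
  proof (rule sum.cong)
    fix j
    have "S j \<times> {axis j (1::real)} = (\<lambda>x. (x, axis j 1)) ` S j" by auto
    then show "(\<Sum>p\<in>S j \<times> {axis j 1}. g p) = (\<Sum>x\<in>S j. g (x, axis j 1))"
      by (simp add: sum.reindex inj_on_def)
  qed simp
  finally show ?thesis .
qed

lemma finite_cayley_points:
  fixes S :: "'m::finite \<Rightarrow> (real^'d::finite) set"
  assumes "\<forall>j\<in>J. finite (S j)"
  shows "finite (\<Union>j\<in>J. S j \<times> {axis j (1::real)})"
  using assms by auto

lemma card_cayley_points:
  fixes S :: "'m::finite \<Rightarrow> (real^'d::finite) set"
  assumes "\<forall>j\<in>J. finite (S j)"
  shows "card (\<Union>j\<in>J. S j \<times> {axis j (1::real)}) = (\<Sum>j\<in>J. card (S j))"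
  using sum_cayley_points[OF assms, of "\<lambda>_. 1::nat"] by simp

text \<open>The component \<open>axis j 1\<close> marks the block of a point, so the second
  component of a relation splits into one balance condition per block. Linear and affine
  dependencies of Cayley points therefore coincide.\<close>

lemma sum_scaleR_cayley_points:
  fixes S :: "'m::finite \<Rightarrow> (real^'d::finite) set"
  assumes "\<forall>j\<in>J. finite (S j)"
  shows "(\<Sum>p\<in>(\<Union>j\<in>J. S j \<times> {axis j (1::real)}). u p *\<^sub>R p) = 0 \<longleftrightarrow>
    (\<Sum>j\<in>J. \<Sum>x\<in>S j. u (x, axis j 1) *\<^sub>R x) = 0 \<and> (\<forall>j\<in>J. (\<Sum>x\<in>S j. u (x, axis j 1)) = 0)"
proof -
  let ?z = "\<Sum>j\<in>J. \<Sum>x\<in>S j. u (x, axis j 1) *\<^sub>R (x, axis j (1::real))"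
  have fst_z: "fst ?z = (\<Sum>j\<in>J. \<Sum>x\<in>S j. u (x, axis j 1) *\<^sub>R x)"
    by (simp add: fst_sum)
  have snd_z: "snd ?z $ i = (if i \<in> J then \<Sum>x\<in>S i. u (x, axis i 1) else 0)" for i
  proof -
    have "snd ?z $ i = (\<Sum>j\<in>J. \<Sum>x\<in>S j. u (x, axis j 1) * (if i = j then 1 else 0))"
      by (simp add: snd_sum axis_def)
    also have "\<dots> = (\<Sum>j\<in>J. if i = j then \<Sum>x\<in>S j. u (x, axis j 1) else 0)"
      by (intro sum.cong) auto
    finally show ?thesis by simp
  qed
  show ?thesis
    unfolding sum_cayley_points[OF assms] prod_eq_iff[of ?z] fst_zero snd_zero fst_z
      vec_eq_iff[of "snd ?z"] snd_z zero_index by auto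
qed

text \<open>An affine dependency of the Cayley points of \<open>S\<close>, extended by zero,
  satisfies the sign condition off \<open>S\<close> trivially.\<close>

lemma simplex_cayley:
  fixes X S :: "'m::finite \<Rightarrow> (real^'d::finite) set"
  assumes X: "\<And>j. j \<in> J \<Longrightarrow> finite (X j)" and S: "\<And>j. j \<in> J \<Longrightarrow> S j \<subseteq> X j"
    and nd: "no_dependency J X S (\<lambda>_ x. x)"
  shows "(int (\<Sum>j\<in>J. card (S j)) - 1) simplex (cayley J S)"
  unfolding simplex_def
proof (intro exI conjI)
  let ?C = "\<Union>j\<in>J. S j \<times> {axis j (1::real)}"
  have finS: "\<forall>j\<in>J. finite (S j)" using X S finite_subset by blast
  show "cayley J S = convex hull ?C" by (simp add: cayley_def)
  show "int (card ?C) = int (\<Sum>j\<in>J. card (S j)) - 1 + 1" using card_cayley_points[OF finS] by simp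
  show "\<not> affine_dependent ?C"
  proof
    assume "affine_dependent ?C"
    then obtain U where U: "(\<Sum>p\<in>?C. U p *\<^sub>R p) = 0" "\<exists>p\<in>?C. U p \<noteq> 0"
      using affine_dependent_explicit_finite[OF finite_cayley_points[OF finS]] by blast
    define w where "w j x = (if x \<in> S j then U (x, axis j 1) else 0)" for j x
    have w: "(\<Sum>x\<in>X j. w j x) = (\<Sum>x\<in>S j. U (x, axis j 1))"
        "(\<Sum>x\<in>X j. w j x *\<^sub>R x) = (\<Sum>x\<in>S j. U (x, axis j 1) *\<^sub>R x)" if "j \<in> J" for j
    proof -
      have "sum (w j) (X j) = sum (w j) (S j)"
        by (rule sum.mono_neutral_right) (use X S that in \<open>auto simp: w_def\<close>)
      then show "(\<Sum>x\<in>X j. w j x) = (\<Sum>x\<in>S j. U (x, axis j 1))" by (simp add: w_def)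
      have "(\<Sum>x\<in>X j. w j x *\<^sub>R x) = (\<Sum>x\<in>S j. w j x *\<^sub>R x)"
        by (rule sum.mono_neutral_right) (use X S that in \<open>auto simp: w_def\<close>)
      then show "(\<Sum>x\<in>X j. w j x *\<^sub>R x) = (\<Sum>x\<in>S j. U (x, axis j 1) *\<^sub>R x)" by (simp add: w_def)
    qed
    moreover have "\<forall>j\<in>J. (\<Sum>x\<in>S j. U (x, axis j 1)) = 0" "(\<Sum>j\<in>J. \<Sum>x\<in>S j. U (x, axis j 1) *\<^sub>R x) = 0"
      using U(1) unfolding sum_scaleR_cayley_points[OF finS] by auto
    moreover have "\<forall>j\<in>J. \<forall>x\<in>X j - S j. 0 \<le> w j x" by (simp add: w_def)
    ultimately have "\<forall>j\<in>J. \<forall>x\<in>X j. w j x = 0"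
      using nd unfolding no_dependency_def by simp
    then show False using U(2) S unfolding w_def by fastforce
  qed
qed

text \<open>Weights on the points pull back along the injective \<open>v j\<close>. This passes from
  curve parameters to the vertices themselves.\<close>

lemma no_dependency_image:
  fixes v :: "'m \<Rightarrow> 'i \<Rightarrow> 'a::real_vector"
  assumes inj: "\<And>j. j \<in> J \<Longrightarrow> inj_on (v j) (T j)" and S: "\<And>j. j \<in> J \<Longrightarrow> S j \<subseteq> T j"
    and nd: "no_dependency J T S v"
  shows "no_dependency J (\<lambda>j. v j ` T j) (\<lambda>j. v j ` S j) (\<lambda>_ x. x)"
  unfolding no_dependency_def
proof (intro allI impI)
  fix w :: "'m \<Rightarrow> 'a \<Rightarrow> real"
  assume w: "\<forall>j\<in>J. (\<Sum>x\<in>v j ` T j. w j x) = 0" "\<forall>j\<in>J. \<forall>x\<in>v j ` T j - v j ` S j. 0 \<le> w j x"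
    "(\<Sum>j\<in>J. \<Sum>x\<in>v j ` T j. w j x *\<^sub>R x) = 0"
  define w' where "w' j t = w j (v j t)" for j t
  have "\<forall>j\<in>J. (\<Sum>t\<in>T j. w' j t) = 0"
    using w(1) inj unfolding w'_def by (simp add: sum.reindex)
  moreover have "\<forall>j\<in>J. \<forall>t\<in>T j - S j. 0 \<le> w' j t"
  proof (intro ballI)
    fix j t assume "j \<in> J" "t \<in> T j - S j"
    then have "v j t \<in> v j ` T j - v j ` S j" using inj S by (auto dest: inj_onD)
    then show "0 \<le> w' j t" using w(2) \<open>j \<in> J\<close> unfolding w'_def by blast
  qed
  moreover have "(\<Sum>j\<in>J. \<Sum>t\<in>T j. w' j t *\<^sub>R v j t) = 0"
    using w(3) inj unfolding w'_def by (simp add: sum.reindex cong: sum.cong)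
  ultimately have "\<forall>j\<in>J. \<forall>t\<in>T j. w' j t = 0"
    using nd unfolding no_dependency_def by blast
  then show "\<forall>j\<in>J. \<forall>x\<in>v j ` T j. w j x = 0" unfolding w'_def by auto
qed

subsection \<open>Nonexistence\<close>

lemma polytope_set_sum:
  fixes P :: "'m \<Rightarrow> 'a::euclidean_space set"
  assumes "finite J" "\<And>j. j \<in> J \<Longrightarrow> polytope (P j)"
  shows "polytope (\<Sum>j\<in>J. P j)"
proof -
  have "\<forall>j\<in>J. \<exists>V. finite V \<and> P j = convex hull V"
    using assms(2) unfolding polytope_def by blast
  then obtain V where V: "\<forall>j\<in>J. finite (V j) \<and> P j = convex hull (V j)" by metis
  have "(\<Sum>j\<in>J. P j) = convex hull (\<Sum>j\<in>J. V j)"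
    using V by (simp add: convex_hull_set_sum)
  moreover have "finite (\<Sum>j\<in>J. V j)"
    using assms(1) V by (induction J rule: finite_induct) (auto simp: finite_set_plus)
  ultimately show ?thesis unfolding polytope_def by blast
qed

lemma finite_verts: "polytope P \<Longrightarrow> finite (verts P)"
  for P :: "'a::euclidean_space set"
  unfolding verts_def by (simp add: finite_polyhedron_extreme_points polytope_imp_polyhedron)

lemma convex_hull_verts: "polytope P \<Longrightarrow> P = convex hull (verts P)"
  for P :: "'a::euclidean_space set"
  unfolding verts_def by (intro Krein_Milman_Minkowski polytope_imp_compact polytope_imp_convex)

text \<open>Faces of polytopes are exposed. Exchanging one summand at a time turns the maximum of
  \<open>c\<close> over the sum into a maximum over each \<open>P j\<close>. A further vertex of
  \<open>P j\<close> at height \<open>M j\<close> would produce a maximizer of \<open>c\<close>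
  outside the face.\<close>

lemma minkowski_face_functional:
  fixes P S :: "'m \<Rightarrow> 'a::euclidean_space set"
  assumes J: "finite J" and P: "\<And>j. j \<in> J \<Longrightarrow> polytope (P j)"
    and S: "\<And>j. j \<in> J \<Longrightarrow> S j \<subseteq> verts (P j)" "\<And>j. j \<in> J \<Longrightarrow> S j \<noteq> {}"
    and face: "(\<Sum>j\<in>J. convex hull (S j)) face_of (\<Sum>j\<in>J. P j)"
  obtains c M where "\<And>j p. j \<in> J \<Longrightarrow> p \<in> P j \<Longrightarrow> c \<bullet> p \<le> M j"
    "\<And>j s. j \<in> J \<Longrightarrow> s \<in> S j \<Longrightarrow> c \<bullet> s = M j"
    "\<And>j v. j \<in> J \<Longrightarrow> v \<in> verts (P j) \<Longrightarrow> c \<bullet> v = M j \<Longrightarrow> v \<in> S j"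
proof -
  let ?F = "\<Sum>j\<in>J. convex hull (S j)" and ?P = "\<Sum>j\<in>J. P j"
  have verts_sub: "verts (P j) \<subseteq> P j" for j
    unfolding verts_def extreme_point_of_def by auto
  have SP: "S j \<subseteq> P j" if "j \<in> J" for j using S(1)[OF that] verts_sub by blast
  have "?F exposed_face_of ?P"
    using face exposed_face_of_polyhedron[OF polytope_imp_polyhedron] polytope_set_sum[of J P] J P by blast
  then obtain c b where c: "?P \<subseteq> {x. c \<bullet> x \<le> b}" "?F = ?P \<inter> {x. c \<bullet> x = b}"
    unfolding exposed_face_of_def by blast
  have memF: "sum f J \<in> ?F" if "\<And>j. j \<in> J \<Longrightarrow> f j \<in> S j" for f
    using that by (auto simp: set_sum_alt[OF J] hull_inc)
  have memP: "sum f J \<in> ?P" if "\<And>j. j \<in> J \<Longrightarrow> f j \<in> P j" for f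
    using that by (auto simp: set_sum_alt[OF J])
  have exch: "sum (f(j := p)) J = sum f J - f j + p" if "j \<in> J" for f :: "'m \<Rightarrow> 'a" and j p
  proof -
    have "sum (f(j := p)) J = p + sum (f(j := p)) (J - {j})"
      using J that by (simp add: sum.remove)
    also have "sum (f(j := p)) (J - {j}) = sum f (J - {j})" by (intro sum.cong) auto
    also have "\<dots> = sum f J - f j" using J that by (simp add: sum_diff1)
    finally show ?thesis by simp
  qed
  define s where "s j = (SOME x. x \<in> S j)" for j
  have s: "s j \<in> S j" if "j \<in> J" for j
    unfolding s_def some_in_eq by (rule S(2)[OF that])
  define M where "M j = c \<bullet> s j" for j
  have cs: "c \<bullet> sum s J = b" using memF[OF s] c(2) by blast
  show ?thesis
  proof (rule that)
    show le: "c \<bullet> p \<le> M j" if "j \<in> J" "p \<in> P j" for j p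
    proof -
      have "sum (s(j := p)) J \<in> ?P" by (rule memP) (use that s SP in auto)
      then have "c \<bullet> (sum s J - s j + p) \<le> b" using c(1) exch[OF that(1), of s p] by auto
      then show ?thesis using cs by (simp add: M_def inner_simps)
    qed
    show "c \<bullet> t = M j" if "j \<in> J" "t \<in> S j" for j t
    proof -
      have "sum (s(j := t)) J \<in> ?F" by (rule memF) (use that s in auto)
      then have "c \<bullet> (sum s J - s j + t) = b" using c(2) exch[OF that(1), of s t] by auto
      then show ?thesis using cs by (simp add: M_def inner_simps)
    qed
    show "v \<in> S j" if "j \<in> J" "v \<in> verts (P j)" "c \<bullet> v = M j" for j v
    proof (rule ccontr)
      assume "v \<notin> S j"
      have finS: "finite (S i)" if "i \<in> J" for i
        using S(1)[OF that] finite_verts[OF P[OF that]] finite_subset by blast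
      have "convex hull (S j) \<subseteq> P j"
        using SP[OF that(1)] P[OF that(1)] by (simp add: hull_minimal polytope_imp_convex)
      then have "v \<notin> convex hull (S j)"
        using that(2) \<open>v \<notin> S j\<close> extreme_point_of_convex_hull[of v "S j"]
        unfolding verts_def extreme_point_of_def by blast
      moreover have "closed (convex hull (S j))"
        using finS[OF that(1)] by (simp add: compact_imp_closed finite_imp_compact_convex_hull)
      ultimately obtain a \<beta> where a: "a \<bullet> v < \<beta>" "\<forall>x\<in>convex hull (S j). \<beta> < a \<bullet> x"
        using separating_hyperplane_closed_point[of "convex hull (S j)" v] by auto
      \<comment> \<open>With each \<open>t i\<close> minimizing \<open>a\<close> on
        \<open>S i\<close>, and \<open>v\<close> strictly below the hull of \<open>S j\<close>, the
        sum with \<open>v\<close> in place of \<open>t j\<close> has a smaller value of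
        \<open>a\<close> than every point of the face, although it maximizes
        \<open>c\<close>.\<close>
      have "\<exists>t\<in>S i. \<forall>x\<in>S i. a \<bullet> t \<le> a \<bullet> x" if "i \<in> J" for i
        using finS[OF that] S(2)[OF that] by (meson arg_min_if_finite linorder_not_less)
      then obtain t where t: "\<And>i. i \<in> J \<Longrightarrow> t i \<in> S i" "\<And>i x. i \<in> J \<Longrightarrow> x \<in> S i \<Longrightarrow> a \<bullet> t i \<le> a \<bullet> x"
        by metis
      have "v \<in> P j" using that(2) verts_sub by blast
      moreover have "t i \<in> P i" if "i \<in> J" for i using t(1)[OF that] SP[OF that] by blast
      ultimately have "sum (t(j := v)) J \<in> ?P" by (intro memP) auto
      moreover have "c \<bullet> sum (t(j := v)) J = b"
      proof -
        have "c \<bullet> sum t J = b" using memF[OF t(1)] c(2) by blast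
        moreover have "c \<bullet> t j = M j"
        proof -
          have "sum (s(j := t j)) J \<in> ?F" by (rule memF) (use that s t in auto)
          then have "c \<bullet> (sum s J - s j + t j) = b" using c(2) exch[OF that(1), of s "t j"] by auto
          then show ?thesis using cs by (simp add: M_def inner_simps)
        qed
        ultimately show ?thesis using exch[OF that(1), of t v] that(3) by (simp add: inner_simps)
      qed
      ultimately have "sum (t(j := v)) J \<in> ?F" using c(2) by blast
      then obtain f where f: "sum (t(j := v)) J = sum f J" "\<forall>i\<in>J. f i \<in> convex hull (S i)"
        unfolding set_sum_alt[OF J] by auto
      have "a \<bullet> t i \<le> a \<bullet> f i" if "i \<in> J" for i
      proof -
        have "convex hull (S i) \<subseteq> {x. a \<bullet> t i \<le> a \<bullet> x}"
          using t(2)[OF that] by (intro hull_minimal convex_halfspace_ge) auto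
        then show ?thesis using f(2) that by blast
      qed
      then have "(\<Sum>i\<in>J. a \<bullet> (t(j := v)) i) < (\<Sum>i\<in>J. a \<bullet> f i)"
        using that(1) a f(2) by (intro sum_strict_mono_ex1[OF J] ballI bexI[of _ j]) force+
      then show False using f(1) by (simp add: inner_sum_right[symmetric])
    qed
  qed
qed

text \<open>A functional that exposes the face spanned by the small side \<open>A\<close> has gap
  \<open>M j - c \<bullet> x\<close> zero on \<open>A\<close>. By balance the weighted gaps on
  \<open>B\<close> sum to zero as well, so \<open>y\<close> attains the maximum and would have to
  belong to \<open>A i\<close>.\<close>

lemma balanced_vertices_not_neighborly:
  fixes P :: "'m::finite \<Rightarrow> (real^'d::finite) set" and A B :: "'m \<Rightarrow> (real^'d) set"
  assumes P: "\<And>j. polytope (P j)" "\<And>j. verts (P j) \<noteq> {}" and nb: "minkowski_neighborly k l P"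
    and J: "card J = l" "J' \<subseteq> J" "i \<in> J'" "y \<in> B i"
    and AB: "\<And>j. j \<in> J' \<Longrightarrow> A j \<subseteq> verts (P j) \<and> B j \<subseteq> verts (P j) \<and> A j \<noteq> {} \<and> A j \<inter> B j = {}"
    and b: "\<And>j x. j \<in> J' \<Longrightarrow> x \<in> B j \<Longrightarrow> 0 < b j x"
    and bal: "\<And>j. j \<in> J' \<Longrightarrow> (\<Sum>x\<in>A j. a j x) = (\<Sum>x\<in>B j. b j x)"
      "(\<Sum>j\<in>J'. \<Sum>x\<in>A j. a j x *\<^sub>R x) = (\<Sum>j\<in>J'. \<Sum>x\<in>B j. b j x *\<^sub>R x)"
    and card: "(\<Sum>j\<in>J'. card (A j)) + 1 \<le> k + card J'"
  shows False
proof -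
  define v where "v j = (SOME x. x \<in> verts (P j))" for j
  have v: "v j \<in> verts (P j)" for j
    unfolding v_def some_in_eq by (rule P(2))
  \<comment> \<open>A block outside \<open>J'\<close> is filled by a single vertex, which raises the
    number of vertices and the bound \<open>k + card J - 1\<close> by one each.\<close>
  define S where "S j = (if j \<in> J' then A j else {v j})" for j
  have S: "S j \<noteq> {}" "S j \<subseteq> verts (P j)" for j
    using AB[of j] v[of j] unfolding S_def by auto
  have "(\<Sum>j\<in>J. card (S j)) = (\<Sum>j\<in>J - J'. card (S j)) + (\<Sum>j\<in>J'. card (S j))"
    using J(2) by (simp add: sum.subset_diff)
  also have "\<dots> = card (J - J') + (\<Sum>j\<in>J'. card (A j))" by (simp add: S_def)
  finally have "(\<Sum>j\<in>J. card (S j)) + card J' = card J + (\<Sum>j\<in>J'. card (A j))"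
    using card_Diff_subset[of J' J] card_mono[of J J'] J(2) by simp
  then have "int (\<Sum>j\<in>J. card (S j)) \<le> int k + int (card J) - 1" using card by linarith
  then have face: "(\<Sum>j\<in>J. convex hull (S j)) face_of (\<Sum>j\<in>J. P j)"
    using nb J(1) S unfolding minkowski_neighborly_def by blast
  obtain c M where c: "\<And>j p. j \<in> J \<Longrightarrow> p \<in> P j \<Longrightarrow> c \<bullet> p \<le> M j"
    "\<And>j s. j \<in> J \<Longrightarrow> s \<in> S j \<Longrightarrow> c \<bullet> s = M j"
    "\<And>j v. j \<in> J \<Longrightarrow> v \<in> verts (P j) \<Longrightarrow> c \<bullet> v = M j \<Longrightarrow> v \<in> S j"
    using minkowski_face_functional[OF finite P(1) S(2) S(1) face] by blast
  have finB: "finite (B j)" if "j \<in> J'" for j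
    using AB[OF that] finite_verts[OF P(1)] finite_subset by blast
  have gap: "0 \<le> b j x * (M j - c \<bullet> x)" if "j \<in> J'" "x \<in> B j" for j x
  proof -
    have "x \<in> P j" using AB[OF that(1)] that(2) unfolding verts_def extreme_point_of_def by auto
    then show ?thesis using c(1)[of j x] b[OF that] J(2) that by auto
  qed
  \<comment> \<open>The block sums control the coefficients of the \<open>M j\<close> and the vector
    sum controls the rest, so balanced weights on \<open>A\<close> and \<open>B\<close> give equal
    totals.\<close>
  have expand: "(\<Sum>j\<in>J'. \<Sum>x\<in>X j. u j x * (M j - c \<bullet> x))
      = (\<Sum>j\<in>J'. M j * (\<Sum>x\<in>X j. u j x)) - c \<bullet> (\<Sum>j\<in>J'. \<Sum>x\<in>X j. u j x *\<^sub>R x)"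
    for u and X :: "'m \<Rightarrow> (real^'d) set"
    by (simp add: inner_sum_right sum_subtractf sum_distrib_left right_diff_distrib mult.commute)
  have "(\<Sum>j\<in>J'. \<Sum>x\<in>B j. b j x * (M j - c \<bullet> x)) = (\<Sum>j\<in>J'. \<Sum>x\<in>A j. a j x * (M j - c \<bullet> x))"
    unfolding expand bal(2) using bal(1) by simp
  also have "\<dots> = 0"
  proof (intro sum.neutral ballI)
    fix j x assume "j \<in> J'" "x \<in> A j"
    then have "c \<bullet> x = M j" using c(2)[of j x] J(2) by (auto simp: S_def)
    then show "a j x * (M j - c \<bullet> x) = 0" by simp
  qed
  finally have "(\<Sum>x\<in>B i. b i x * (M i - c \<bullet> x)) = 0"
    using J(3) gap by (subst (asm) sum_nonneg_eq_0_iff) (auto intro: sum_nonneg)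
  then have "b i y * (M i - c \<bullet> y) = 0"
    using J(3,4) gap finB by (subst (asm) sum_nonneg_eq_0_iff) auto
  then have "c \<bullet> y = M i" using b[OF J(3,4)] by simp
  then have "y \<in> S i" using c(3)[of i y] AB[OF J(3)] J by blast
  then show False using AB[OF J(3)] J(3,4) by (auto simp: S_def)
qed

text \<open>The positive part \<open>A\<close> and the negative part \<open>B\<close> of
  \<open>w\<close> balance each other, and both cannot be large: together they have at most
  \<open>2 * k + 2 * card J' - 1\<close> elements, so one of them has at most
  \<open>k + card J' - 1\<close>.\<close>

lemma dependency_not_neighborly:
  fixes P :: "'m::finite \<Rightarrow> (real^'d::finite) set" and W :: "'m \<Rightarrow> (real^'d) set"
  assumes P: "\<And>j. polytope (P j)" "\<And>j. verts (P j) \<noteq> {}" and nb: "minkowski_neighborly k l P"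
    and J: "card J = l" "J0 \<subseteq> J"
    and W: "\<And>j. j \<in> J0 \<Longrightarrow> W j \<subseteq> verts (P j)" "\<And>j. j \<in> J0 \<Longrightarrow> 2 \<le> card (W j)"
      "(\<Sum>j\<in>J0. card (W j)) \<le> CARD('d) + card J0 + 1"
    and k: "CARD('d) + 2 \<le> 2 * k + card J0"
    and w: "\<And>j. j \<in> J0 \<Longrightarrow> (\<Sum>x\<in>W j. w j x) = 0" "(\<Sum>j\<in>J0. \<Sum>x\<in>W j. w j x *\<^sub>R x) = 0"
    and i: "i \<in> J0" "y \<in> W i" "w i y \<noteq> 0"
  shows False
proof -
  \<comment> \<open>In these blocks the zero block sum makes both parts nonempty, so either part is
    an admissible choice of vertices.\<close>
  define J' where "J' = {j \<in> J0. \<exists>x\<in>W j. w j x \<noteq> 0}"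
  define A where "A j = {x \<in> W j. 0 < w j x}" for j
  define B where "B j = {x \<in> W j. w j x < 0}" for j
  have finW: "finite (W j)" if "j \<in> J0" for j
    using W(2)[OF that] by (metis card.infinite not_numeral_le_zero)
  have J'0: "J' \<subseteq> J0" "i \<in> J'" unfolding J'_def using i by auto
  have split: "(\<Sum>x\<in>W j. g x) = (\<Sum>x\<in>A j. g x) + (\<Sum>x\<in>B j. g x)"
    if "j \<in> J0" and g0: "\<And>x. w j x = 0 \<Longrightarrow> g x = 0" for j and g :: "real^'d \<Rightarrow> 'x::ab_group_add"
  proof -
    have "g x = 0" if "x \<in> W j - (A j \<union> B j)" for x
      using that g0[of x] unfolding A_def B_def by fastforce
    then have "(\<Sum>x\<in>W j. g x) = (\<Sum>x\<in>A j \<union> B j. g x)"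
      by (intro sum.mono_neutral_right) (use finW that(1) in \<open>auto simp: A_def B_def\<close>)
    also have "\<dots> = (\<Sum>x\<in>A j. g x) + (\<Sum>x\<in>B j. g x)"
      by (rule sum.union_disjoint) (use finW that in \<open>auto simp: A_def B_def\<close>)
    finally show ?thesis .
  qed
  have bal1: "(\<Sum>x\<in>A j. w j x) = (\<Sum>x\<in>B j. - w j x)" if "j \<in> J0" for j
    using split[OF that, of "w j"] w(1)[OF that] by (simp add: sum_negf add_eq_0_iff2)
  have zero: "(\<Sum>x\<in>W j. w j x *\<^sub>R x) = 0" if "j \<in> J0 - J'" for j
    using that unfolding J'_def by (intro sum.neutral) auto
  have "0 = (\<Sum>j\<in>J'. \<Sum>x\<in>W j. w j x *\<^sub>R x)"
    unfolding w(2)[symmetric] by (rule sum.mono_neutral_right) (use zero J'0 in auto)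
  also have "\<dots> = (\<Sum>j\<in>J'. (\<Sum>x\<in>A j. w j x *\<^sub>R x) + (\<Sum>x\<in>B j. w j x *\<^sub>R x))"
    by (intro sum.cong refl split) (use J'0 in auto)
  finally have bal2: "(\<Sum>j\<in>J'. \<Sum>x\<in>A j. w j x *\<^sub>R x) = (\<Sum>j\<in>J'. \<Sum>x\<in>B j. (- w j x) *\<^sub>R x)"
    by (simp add: sum.distrib sum_negf add_eq_0_iff2)
  have ne: "A j \<noteq> {}" "B j \<noteq> {}" if "j \<in> J'" for j
  proof -
    have j: "j \<in> J0" "\<exists>x\<in>W j. w j x \<noteq> 0" using that unfolding J'_def by auto
    have fin: "finite (A j)" "finite (B j)" unfolding A_def B_def using finW[OF j(1)] by auto
    have pos: "A j \<noteq> {} \<Longrightarrow> 0 < (\<Sum>x\<in>A j. w j x)" "B j \<noteq> {} \<Longrightarrow> 0 < (\<Sum>x\<in>B j. - w j x)"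
      by (rule sum_pos; use fin in \<open>simp add: A_def B_def\<close>)+
    show "A j \<noteq> {}"
    proof
      assume "A j = {}"
      then have "B j = {}" using pos(2) bal1[OF j(1)] by force
      then show False using \<open>A j = {}\<close> j(2) unfolding A_def B_def by (auto simp: neq_iff)
    qed
    show "B j \<noteq> {}"
    proof
      assume "B j = {}"
      then have "A j = {}" using pos(1) bal1[OF j(1)] by force
      then show False using \<open>B j = {}\<close> j(2) unfolding A_def B_def by (auto simp: neq_iff)
    qed
  qed
  have "card (A j) + card (B j) \<le> card (W j)" if "j \<in> J0" for j
  proof -
    have "card (A j) + card (B j) = card (A j \<union> B j)"
      by (rule card_Un_disjoint[symmetric]) (use finW[OF that] in \<open>auto simp: A_def B_def\<close>)
    also have "\<dots> \<le> card (W j)" by (rule card_mono) (use finW[OF that] in \<open>auto simp: A_def B_def\<close>)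
    finally show ?thesis .
  qed
  then have "(\<Sum>j\<in>J'. card (A j) + card (B j)) \<le> (\<Sum>j\<in>J'. card (W j))"
    using J'0 by (intro sum_mono) auto
  moreover have "(\<Sum>j\<in>J0. card (W j)) = (\<Sum>j\<in>J0 - J'. card (W j)) + (\<Sum>j\<in>J'. card (W j))"
    using J'0 by (simp add: sum.subset_diff)
  moreover have "2 * card (J0 - J') \<le> (\<Sum>j\<in>J0 - J'. card (W j))"
    using sum_bounded_below[of "J0 - J'" 2 "\<lambda>j. card (W j)"] W(2) by (simp add: mult.commute)
  moreover have "card (J0 - J') + card J' = card J0"
    using card_Diff_subset[of J' J0] card_mono[of J0 J'] J'0 by simp
  \<comment> \<open>The total for \<open>J0\<close> is at most
    \<open>2 * k + 2 * card J0 - 1\<close>. Each discarded block has at least two vertices, so the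
    bound descends to \<open>J'\<close>.\<close>
  ultimately have "(\<Sum>j\<in>J'. card (A j)) + (\<Sum>j\<in>J'. card (B j)) \<le> 2 * k + 2 * card J' - 1"
    using W(3) k by (simp add: sum.distrib)
  \<comment> \<open>This keeps the subtraction of 1 from being truncated.\<close>
  moreover have "0 < card J'" using J'0 by (auto simp: card_gt_0_iff)
  ultimately have "(\<Sum>j\<in>J'. card (A j)) + 1 \<le> k + card J' \<or> (\<Sum>j\<in>J'. card (B j)) + 1 \<le> k + card J'"
    by linarith
  then show False
  proof
    assume card: "(\<Sum>j\<in>J'. card (A j)) + 1 \<le> k + card J'"
    obtain z where z: "z \<in> B i" using ne(2)[OF J'0(2)] by blast
    show False
    proof (rule balanced_vertices_not_neighborly[OF P nb J(1) _ J'0(2), of z B A "\<lambda>j x. - w j x" w])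
      show "A j \<subseteq> verts (P j) \<and> B j \<subseteq> verts (P j) \<and> A j \<noteq> {} \<and> A j \<inter> B j = {}" if "j \<in> J'" for j
        using W(1)[of j] ne[OF that] J'0 that by (auto simp: A_def B_def)
    qed (use J J'0 z bal1 bal2 card in \<open>auto simp: B_def\<close>)
  next
    assume card: "(\<Sum>j\<in>J'. card (B j)) + 1 \<le> k + card J'"
    obtain z where z: "z \<in> A i" using ne(1)[OF J'0(2)] by blast
    show False
    proof (rule balanced_vertices_not_neighborly[OF P nb J(1) _ J'0(2), of z A B w "\<lambda>j x. - w j x"])
      show "B j \<subseteq> verts (P j) \<and> A j \<subseteq> verts (P j) \<and> B j \<noteq> {} \<and> B j \<inter> A j = {}" if "j \<in> J'" for j
        using W(1)[of j] ne[OF that] J'0 that by (auto simp: A_def B_def)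
      show "(\<Sum>x\<in>B j. - w j x) = (\<Sum>x\<in>A j. w j x)" if "j \<in> J'" for j
        using bal1[of j] that J'0 by auto
    qed (use J J'0 z bal2[symmetric] card in \<open>auto simp: A_def\<close>)
  qed
qed

text \<open>The Cayley points over \<open>J\<close> lie in a space spanned by
  \<open>CARD('d) + card J\<close> vectors, so any larger number of them is linearly
  dependent.\<close>

lemma dependent_cayley_points:
  fixes W :: "'m::finite \<Rightarrow> (real^'d::finite) set"
  assumes fin: "\<forall>j\<in>J. finite (W j)" and card: "CARD('d) + card J < (\<Sum>j\<in>J. card (W j))"
  obtains w i y where "\<And>j. j \<in> J \<Longrightarrow> (\<Sum>x\<in>W j. w j x) = (0::real)" "(\<Sum>j\<in>J. \<Sum>x\<in>W j. w j x *\<^sub>R x) = 0"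
    "i \<in> J" "y \<in> W i" "w i y \<noteq> 0"
proof -
  let ?C = "\<Union>j\<in>J. W j \<times> {axis j (1::real)}"
  let ?G = "(\<lambda>b. (b, 0)) ` Basis \<union> (\<lambda>j. (0, axis j (1::real))) ` J :: ((real^'d) \<times> (real^'m)) set"
  have "?C \<subseteq> span ?G"
  proof (clarify)
    fix j x assume "j \<in> J" "x \<in> W j"
    have "(x, axis j (1::real)) = (\<Sum>b\<in>Basis. (x \<bullet> b) *\<^sub>R (b, 0)) + (0, axis j 1)"
      by (simp add: prod_eq_iff fst_sum snd_sum euclidean_representation)
    moreover have "(\<Sum>b\<in>Basis. (x \<bullet> b) *\<^sub>R (b, 0 :: real^'m)) \<in> span ?G"
      by (intro span_sum span_scale span_base) auto
    moreover have "(0, axis j 1) \<in> span ?G" using \<open>j \<in> J\<close> by (intro span_base) auto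
    ultimately show "(x, axis j 1) \<in> span ?G" by (simp only: span_add)
  qed
  then have "dim ?C \<le> card ?G" by (rule dim_le_card) auto
  also have "\<dots> \<le> card ((\<lambda>b::real^'d. (b, 0::real^'m)) ` Basis) + card ((\<lambda>j. (0::real^'d, axis j (1::real))) ` J)"
    by (rule card_Un_le)
  also have "\<dots> \<le> CARD('d) + card J"
    using card_image_le[of "Basis :: (real^'d) set" "\<lambda>b. (b, 0::real^'m)"]
      card_image_le[of J "\<lambda>j. (0::real^'d, axis j (1::real))"] by simp
  finally have "dim ?C < card ?C" using card card_cayley_points[OF fin] by simp
  then have "dependent ?C" by (rule dependent_biggerset_general)
  then obtain u where u: "(\<Sum>p\<in>?C. u p *\<^sub>R p) = 0" "\<exists>p\<in>?C. u p \<noteq> 0"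
    unfolding dependent_finite[OF finite_cayley_points[OF fin]] by blast
  then obtain i y where iy: "i \<in> J" "y \<in> W i" "u (y, axis i 1) \<noteq> 0" by auto
  have "\<forall>j\<in>J. (\<Sum>x\<in>W j. u (x, axis j 1)) = 0" "(\<Sum>j\<in>J. \<Sum>x\<in>W j. u (x, axis j 1) *\<^sub>R x) = 0"
    using u(1) unfolding sum_scaleR_cayley_points[OF fin] by auto
  then show ?thesis using that[of "\<lambda>j x. u (x, axis j 1)" i y] iy by auto
qed

lemma not_neighborly:
  fixes P :: "'m::finite \<Rightarrow> (real^'d::finite) set"
  assumes P: "\<And>i. polytope (P i)" and pure: "pure_family P"
    and l: "1 \<le> l" "l \<le> CARD('m)" and k: "1 \<le> k" "CARD('d) + 2 \<le> 2 * k + l"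
    and ns: "\<not> (l = 1 \<and> (\<forall>i. int CARD('d) simplex (P i)))"
  shows "\<not> minkowski_neighborly k l P"
proof
  assume nb: "minkowski_neighborly k l P"
  have fin: "finite (verts (P i))" for i using finite_verts[OF P] .
  have large: "CARD('d) + 1 \<le> card (verts (P i))" for i
    using pure unfolding pure_family_def f0_def by blast
  have ne: "verts (P i) \<noteq> {}" for i using large[of i] by auto
  have d: "1 \<le> CARD('d)" using zero_less_card_finite[where 'a = 'd] by linarith
  have bound: False
    if J: "card J = l" "J0 \<subseteq> J" and J0: "CARD('d) + 2 \<le> 2 * k + card J0"
      and W: "\<And>j. j \<in> J0 \<Longrightarrow> W j \<subseteq> verts (P j)" "\<And>j. j \<in> J0 \<Longrightarrow> 2 \<le> card (W j)"
        "(\<Sum>j\<in>J0. card (W j)) = CARD('d) + card J0 + 1" for J J0 W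
  proof -
    have "\<forall>j\<in>J0. finite (W j)" using W(1) fin finite_subset by blast
    moreover have "CARD('d) + card J0 < (\<Sum>j\<in>J0. card (W j))" using W(3) by simp
    ultimately obtain w i y where w: "\<And>j. j \<in> J0 \<Longrightarrow> (\<Sum>x\<in>W j. w j x) = (0::real)"
      "(\<Sum>j\<in>J0. \<Sum>x\<in>W j. w j x *\<^sub>R x) = 0" "i \<in> J0" "y \<in> W i" "w i y \<noteq> 0"
      by (rule dependent_cayley_points) blast
    show False
      by (rule dependency_not_neighborly[OF P ne nb J W(1) W(2) _ J0 w]) (use W(3) in auto)
  qed
  show False
  proof (cases "l = 1")
    case True
    then obtain i where i: "\<not> int CARD('d) simplex (P i)" using ns by blast
    let ?V = "verts (P i)"
    show False
    proof (cases "CARD('d) + 2 \<le> card ?V")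
      case big: True
      then obtain W where W: "W \<subseteq> ?V" "card W = CARD('d) + 2"
        using obtain_subset_with_card_n by metis
      show False by (rule bound[of "{i}" "{i}" "\<lambda>_. W"]) (use True k W in auto)
    next
      case False
      \<comment> \<open>The count alone gives no dependency here. It comes from \<open>P i\<close>
        not being a simplex, as affinely independent vertices would make it one.\<close>
      then have card: "card ?V = CARD('d) + 1" using large[of i] by linarith
      have "affine_dependent ?V"
      proof (rule ccontr)
        assume "\<not> affine_dependent ?V"
        then have "int CARD('d) simplex (P i)"
          unfolding simplex_def using card convex_hull_verts[OF P] by (intro exI[of _ ?V]) simp
        then show False using i by blast
      qed
      then obtain w y where w: "sum w ?V = 0" "y \<in> ?V" "w y \<noteq> 0" "(\<Sum>x\<in>?V. w x *\<^sub>R x) = 0"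
        using affine_dependent_explicit_finite[OF fin] by blast
      show False
        by (rule dependency_not_neighborly[OF P ne nb, of "{i}" "{i}" "\<lambda>_. ?V" "\<lambda>_. w" i y])
           (use True k w card d in auto)
    qed
  next
    case False
    then have l2: "2 \<le> l" using l by simp
    obtain J :: "'m set" where J: "card J = l" using obtain_subset_with_card_n[OF l(2)] by blast
    \<comment> \<open>Two vertices from each of \<open>p - 1\<close> blocks leave
      \<open>CARD('d) + 3 - p\<close> for the last one. This is at least 2 as
      \<open>p \<le> CARD('d) + 1\<close>, and purity supplies that many as
      \<open>2 \<le> p\<close>. If \<open>l\<close> is cut down to \<open>CARD('d) + 1\<close>, the
      bound on \<open>2 * k + p\<close> follows from \<open>1 \<le> k\<close>.\<close>
    define p where "p = min l (CARD('d) + 1)"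
    have p: "2 \<le> p" "p \<le> l" "p \<le> CARD('d) + 1" "CARD('d) + 2 \<le> 2 * k + p"
      unfolding p_def using l2 d k by auto
    obtain J0 where J0: "J0 \<subseteq> J" "card J0 = p" using obtain_subset_with_card_n[of p J] p J by metis
    then obtain j0 where j0: "j0 \<in> J0" using p by fastforce
    define c where "c j = (if j = j0 then CARD('d) + 3 - p else 2)" for j
    have c: "2 \<le> c j" "c j \<le> CARD('d) + 1" for j unfolding c_def using p d by auto
    have "\<exists>W. W \<subseteq> verts (P j) \<and> card W = c j" for j
      using obtain_subset_with_card_n[of "c j" "verts (P j)"] c(2)[of j] large[of j] by (metis le_trans)
    then obtain W where W: "\<And>j. W j \<subseteq> verts (P j)" "\<And>j. card (W j) = c j" by metis
    have "(\<Sum>j\<in>J0. c j) = c j0 + (\<Sum>j\<in>J0 - {j0}. c j)" using j0 by (simp add: sum.remove)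
    also have "(\<Sum>j\<in>J0 - {j0}. c j) = 2 * (p - 1)" using j0 J0 by (simp add: c_def card_Diff_singleton)
    finally have "(\<Sum>j\<in>J0. c j) = CARD('d) + card J0 + 1" using p J0 by (simp add: c_def)
    then show False using bound[OF J J0(1), of W] W c(1) p J0 by simp
  qed
qed

subsection \<open>Points on degenerating moment curves\<close>

lemma pointwise_convergent_subseq:
  fixes f :: "nat \<Rightarrow> 'a \<Rightarrow> real"
  assumes "finite A" and bd: "\<And>n a. a \<in> A \<Longrightarrow> \<bar>f n a\<bar> \<le> B"
  obtains r l where "strict_mono (r :: nat \<Rightarrow> nat)" "\<And>a. a \<in> A \<Longrightarrow> (\<lambda>n. f (r n) a) \<longlonglongrightarrow> l a"
proof -
  have "\<forall>d\<subseteq>A. \<exists>l::'a \<Rightarrow> real. \<exists>r::nat\<Rightarrow>nat. strict_mono r \<and>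
      (\<forall>e>0. eventually (\<lambda>n. \<forall>i\<in>d. dist (f (r n) i) (l i) < e) sequentially)"
  proof (rule compact_lemma_general[where proj = "\<lambda>x. x" and unproj = "\<lambda>x. x"])
    show "bounded ((\<lambda>x. x k) ` range f)" if "k \<in> A" for k
      using bd[OF that] by (auto simp: bounded_iff)
  qed (use assms in auto)
  then obtain l r where lr: "strict_mono (r :: nat \<Rightarrow> nat)"
      "\<forall>e>0. eventually (\<lambda>n. \<forall>i\<in>A. dist (f (r n) i) (l i) < e) sequentially"
    by blast
  show ?thesis
  proof (rule that[OF lr(1)])
    show "(\<lambda>n. f (r n) a) \<longlonglongrightarrow> l a" if "a \<in> A" for a
    proof (rule tendstoI)
      fix e :: real assume "e > 0"
      then have "eventually (\<lambda>n. \<forall>i\<in>A. dist (f (r n) i) (l i) < e) sequentially"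
        using lr(2) by blast
      then show "\<forall>\<^sub>F n in sequentially. dist (f (r n) a) (l a) < e"
        by eventually_elim (use that in blast)
    qed
  qed
qed

section \<open>Polynomial moments of signed weights\<close>

lemma sum_moments_poly:
  fixes \<nu> :: "real \<Rightarrow> real"
  assumes "degree p \<le> n"
  shows "(\<Sum>t\<in>T. \<nu> t * poly p t) = (\<Sum>i\<le>n. coeff p i * (\<Sum>t\<in>T. \<nu> t * t ^ i))"
proof -
  have "poly p t = (\<Sum>i\<le>n. coeff p i * t ^ i)" for t
    unfolding poly_altdef using assms by (intro sum.mono_neutral_left) (auto simp: coeff_eq_0)
  then have "(\<Sum>t\<in>T. \<nu> t * poly p t) = (\<Sum>t\<in>T. \<Sum>i\<le>n. coeff p i * (\<nu> t * t ^ i))"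
    by (simp add: sum_distrib_left mult_ac)
  also have "\<dots> = (\<Sum>i\<le>n. coeff p i * (\<Sum>t\<in>T. \<nu> t * t ^ i))"
    by (subst sum.swap) (simp add: sum_distrib_left)
  finally show ?thesis .
qed

lemma degree_prod_linear:
  fixes x :: "'a \<Rightarrow> real"
  assumes "finite A"
  shows "degree (\<Prod>a\<in>A. [:- x a, 1:]) = card A" "lead_coeff (\<Prod>a\<in>A. [:- x a, 1:]) = 1"
proof -
  show "degree (\<Prod>a\<in>A. [:- x a, 1:]) = card A"
    using assms by (subst degree_prod_eq_sum_degree) auto
  show "lead_coeff (\<Prod>a\<in>A. [:- x a, 1:]) = 1"
    by (subst lead_coeff_prod) simp
qed

text \<open>Test \<open>\<nu> j\<close> against the square of the monic polynomial
  \<open>p j\<close> with root set \<open>S j\<close>. Only the top moment survives, so the weighted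
  total of these nonnegative sums is zero and \<open>\<nu> j\<close> vanishes off
  \<open>S j\<close>. On \<open>S j\<close> the low moments determine the weights by
  interpolation.\<close>

lemma moment_sums_vanish:
  fixes \<nu> :: "'m \<Rightarrow> real \<Rightarrow> real"
  assumes "finite J" and fin: "\<And>j. j \<in> J \<Longrightarrow> finite (T j)"
    and S: "\<And>j. j \<in> J \<Longrightarrow> S j \<subseteq> T j" "\<And>j. j \<in> J \<Longrightarrow> S j \<noteq> {}"
    and nonneg: "\<And>j t. j \<in> J \<Longrightarrow> t \<in> T j - S j \<Longrightarrow> 0 \<le> \<nu> j t"
    and low: "\<And>j i. j \<in> J \<Longrightarrow> i < 2 * card (S j) \<Longrightarrow> (\<Sum>t\<in>T j. \<nu> j t * t ^ i) = 0"
    and \<kappa>: "\<And>j. j \<in> J \<Longrightarrow> 0 < \<kappa> j"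
    and top: "(\<Sum>j\<in>J. \<kappa> j * (\<Sum>t\<in>T j. \<nu> j t * t ^ (2 * card (S j)))) = 0"
    and "j \<in> J" "t \<in> T j"
  shows "\<nu> j t = 0"
proof -
  have finS: "finite (S j)" if "j \<in> J" for j
    using fin S(1) that finite_subset by blast
  define p where "p j = (\<Prod>s\<in>S j. [:- s, 1:])" for j :: 'm
  have p: "degree (p j) = card (S j)" "lead_coeff (p j) = 1" if "j \<in> J" for j
    unfolding p_def using degree_prod_linear[OF finS[OF that], where x = "\<lambda>s. s"] by auto
  have p_pos: "poly (p j) t \<noteq> 0" if "j \<in> J" "t \<notin> S j" for j t
    unfolding p_def poly_prod using that finS by (auto simp: prod_zero_iff)
  have p_zero: "poly (p j) t = 0" if "j \<in> J" "t \<in> S j" for j t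
    unfolding p_def poly_prod using that finS by (auto simp: prod_zero_iff)
  have sq: "(\<Sum>t\<in>T j. \<nu> j t * (poly (p j) t)\<^sup>2) = (\<Sum>t\<in>T j. \<nu> j t * t ^ (2 * card (S j)))"
    if "j \<in> J" for j
  proof -
    let ?n = "2 * card (S j)"
    have p0: "p j \<noteq> 0" using p(2)[OF that] by auto
    have deg: "degree ((p j)\<^sup>2) = ?n"
      using p0 p(1)[OF that] by (simp add: degree_power_eq)
    have lc: "coeff ((p j)\<^sup>2) ?n = 1"
      using p(2)[OF that] deg lead_coeff_power[of "p j" 2] by simp
    have "(\<Sum>t\<in>T j. \<nu> j t * (poly (p j) t)\<^sup>2)
        = (\<Sum>i\<le>?n. coeff ((p j)\<^sup>2) i * (\<Sum>t\<in>T j. \<nu> j t * t ^ i))"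
      using sum_moments_poly[of "(p j)\<^sup>2" ?n "\<nu> j" "T j"] deg by simp
    also have "\<dots> = (\<Sum>i\<in>{?n}. coeff ((p j)\<^sup>2) i * (\<Sum>t\<in>T j. \<nu> j t * t ^ i))"
      by (rule sum.mono_neutral_right) (use low[OF that] in auto)
    finally show ?thesis using lc by simp
  qed
  have sq_nonneg: "0 \<le> \<nu> j t * (poly (p j) t)\<^sup>2" if "j \<in> J" "t \<in> T j" for j t
    using nonneg[of j t] p_zero[of j t] that by (cases "t \<in> S j") auto
  have "(\<Sum>j\<in>J. \<kappa> j * (\<Sum>t\<in>T j. \<nu> j t * (poly (p j) t)\<^sup>2)) = 0"
    using top sq by (simp cong: sum.cong)
  moreover have "0 \<le> \<kappa> j * (\<Sum>t\<in>T j. \<nu> j t * (poly (p j) t)\<^sup>2)" if "j \<in> J" for j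
    using that \<kappa>[OF that] by (intro mult_nonneg_nonneg[OF less_imp_le] sum_nonneg sq_nonneg)
  ultimately have "\<kappa> j * (\<Sum>t\<in>T j. \<nu> j t * (poly (p j) t)\<^sup>2) = 0"
    using \<open>j \<in> J\<close> \<open>finite J\<close> by (simp add: sum_nonneg_eq_0_iff)
  then have "(\<Sum>t\<in>T j. \<nu> j t * (poly (p j) t)\<^sup>2) = 0"
    using \<open>j \<in> J\<close> \<kappa>[of j] by auto
  then have "\<nu> j t * (poly (p j) t)\<^sup>2 = 0" if "t \<in> T j" for t
    using that fin \<open>j \<in> J\<close> sq_nonneg by (subst (asm) sum_nonneg_eq_0_iff) auto
  then have off: "\<nu> j t = 0" if "t \<in> T j - S j" for t
    using that p_pos[OF \<open>j \<in> J\<close>] by auto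
  show ?thesis
  proof (cases "t \<in> S j")
    case True
    \<comment> \<open>A Lagrange polynomial: it isolates the weight at \<open>t\<close>, and its
      degree is low enough for all moments involved to vanish.\<close>
    define g where "g = (\<Prod>s\<in>S j - {t}. [:- s, 1:])"
    have "degree g = card (S j) - 1"
      unfolding g_def using degree_prod_linear(1)[of "S j - {t}" "\<lambda>s. s"] finS True \<open>j \<in> J\<close> by simp
    moreover have "i < 2 * card (S j)" if "i \<le> card (S j) - 1" for i
      using that finS[OF \<open>j \<in> J\<close>] S(2)[OF \<open>j \<in> J\<close>] card_gt_0_iff[of "S j"] by linarith
    ultimately have "(\<Sum>u\<in>T j. \<nu> j u * poly g u) = 0"
      using sum_moments_poly[of g "card (S j) - 1" "\<nu> j" "T j"] low[OF \<open>j \<in> J\<close>]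
      by (simp add: sum.neutral)
    also have "(\<Sum>u\<in>T j. \<nu> j u * poly g u) = (\<Sum>u\<in>{t}. \<nu> j u * poly g u)"
    proof (rule sum.mono_neutral_right)
      show "\<forall>u\<in>T j - {t}. \<nu> j u * poly g u = 0"
      proof
        fix u assume u: "u \<in> T j - {t}"
        show "\<nu> j u * poly g u = 0"
        proof (cases "u \<in> S j")
          case True
          then have "poly g u = 0"
            unfolding g_def poly_prod using u finS \<open>j \<in> J\<close> by (auto simp: prod_zero_iff)
          then show ?thesis by simp
        qed (use off u in auto)
      qed
    qed (use fin \<open>j \<in> J\<close> \<open>t \<in> T j\<close> in auto)
    finally have "\<nu> j t * poly g t = 0" by simp
    moreover have "poly g t \<noteq> 0"
      unfolding g_def poly_prod using finS \<open>j \<in> J\<close> by (auto simp: prod_zero_iff)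
    ultimately show ?thesis by simp
  qed (use off \<open>t \<in> T j\<close> in auto)
qed

section \<open>Placement of the nodes\<close>

text \<open>
  The nodes with indices \<open>2 r\<close> and \<open>2 r + 1\<close> of the same block are adjacent, and the nodes with
  index 1 precede all those with larger index.
\<close>

definition node :: "('m::finite \<Rightarrow> nat) \<Rightarrow> 'm \<Rightarrow> nat \<Rightarrow> int" where
  "node h j i = 2 * (int (h j) + int CARD('m) * int (i div 2)) + int (i mod 2)"

text \<open>The number \<open>h j + CARD('m) * r\<close> encodes the pair of \<open>j\<close> and
  \<open>r\<close> uniquely, in base \<open>CARD('m)\<close>. If it is \<open>y\<close>, the nodes
  with indices \<open>2 * r\<close> and \<open>2 * r + 1\<close> are \<open>2 * y\<close> and
  \<open>2 * y + 1\<close>. No node of another pair lies between them, which gives the equal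
  signs.\<close>

lemma
  fixes h :: "'m::finite \<Rightarrow> nat"
  assumes h: "inj h" "\<And>j. h j < CARD('m)"
  shows node_inj: "node h j i = node h j' i' \<longleftrightarrow> j = j' \<and> i = i'"
    and node_1_less: "2 \<le> i \<Longrightarrow> node h j' 1 < node h j i"
    and node_pair_sign: "(j, s) \<noteq> (j', r) \<Longrightarrow>
      0 < (node h j (2 * s) - node h j' (2 * r)) * (node h j (2 * s) - node h j' (2 * r + 1))"
proof -
  have key: "h j + CARD('m) * s = h j' + CARD('m) * r \<longleftrightarrow> j = j' \<and> s = r" for j j' s r
  proof
    assume eq: "h j + CARD('m) * s = h j' + CARD('m) * r"
    have "(h j + CARD('m) * s) mod CARD('m) = h j" "(h j' + CARD('m) * r) mod CARD('m) = h j'"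
      using h(2) by simp_all
    then have "h j = h j'" using eq by simp
    then show "j = j' \<and> s = r" using eq h(1) by (auto dest: injD)
  qed auto
  have key': "int (h j) + int CARD('m) * int s = int (h j') + int CARD('m) * int r
      \<longleftrightarrow> j = j' \<and> s = r" for j j' s r
    using key[of j s j' r] by (metis of_nat_add of_nat_eq_iff of_nat_mult)
  show "node h j i = node h j' i' \<longleftrightarrow> j = j' \<and> i = i'"
  proof
    assume eq: "node h j i = node h j' i'"
    have "i mod 2 = i' mod 2"
      using eq unfolding node_def by presburger
    moreover from this eq have "j = j' \<and> i div 2 = i' div 2"
      unfolding node_def using key'[of j "i div 2" j' "i' div 2"] by simp
    ultimately show "j = j' \<and> i = i'"
      by (metis div_mult_mod_eq)
  qed auto
  show "node h j' 1 < node h j i" if "2 \<le> i"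
  proof -
    have "CARD('m) * 1 \<le> CARD('m) * (i div 2)"
      using that by (intro mult_le_mono2) linarith
    then have "int (h j') + 1 \<le> int (h j) + int CARD('m) * int (i div 2)"
      using h(2)[of j'] by (metis Suc_eq_plus1 Suc_leI add.commute le_trans mult.right_neutral of_nat_1 of_nat_add of_nat_le_iff of_nat_mult trans_le_add2)
    then show ?thesis unfolding node_def by simp
  qed
  show "0 < (node h j (2 * s) - node h j' (2 * r)) * (node h j (2 * s) - node h j' (2 * r + 1))"
    if "(j, s) \<noteq> (j', r)"
  proof -
    define y where "y = int (h j) + int CARD('m) * int s"
    define z where "z = int (h j') + int CARD('m) * int r"
    have "y \<noteq> z" using key'[of j s j' r] that unfolding y_def z_def by auto
    then have "(y - z > 0 \<and> 2 * y - 2 * z - 1 > 0) \<or> (2 * y - 2 * z < 0 \<and> 2 * y - 2 * z - 1 < 0)"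
      by linarith
    then have "0 < (2 * y - 2 * z) * (2 * y - 2 * z - 1)"
      by (auto intro: mult_pos_pos mult_neg_neg)
    moreover have "node h j (2 * s) = 2 * y" "node h j' (2 * r) = 2 * z" "node h j' (2 * r + 1) = 2 * z + 1"
      unfolding node_def y_def z_def by simp_all
    ultimately show ?thesis by (simp add: diff_diff_add)
  qed
qed

lemma prod_odd_pairs:
  fixes f :: "nat \<Rightarrow> 'a::comm_monoid_mult"
  assumes "1 \<le> s"
  shows "(\<Prod>i\<in>{1..<2 * s}. f i) = f 1 * (\<Prod>r\<in>{1..<s}. f (2 * r) * f (2 * r + 1))"
  using assms
proof (induction s rule: nat_induct_at_least)
  case base
  have "{1..<2 * 1} = {1::nat}" by auto
  then show ?case by simp
next
  case (Suc s)
  have "{1..<2 * Suc s} = insert (2 * s + 1) (insert (2 * s) {1..<2 * s})" using Suc.hyps by auto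
  moreover have "{1..<Suc s} = insert s {1..<s}" using Suc.hyps by auto
  ultimately show ?case using Suc.IH by (simp add: mult_ac)
qed

text \<open>Index 1 contributes a positive factor because its node lies to the left. The other
  indices form adjacent pairs with positive product. In block \<open>j\<close> itself all pairs have
  \<open>r < s j\<close>, so the evaluation node is in none of them.\<close>

lemma prod_node_pos:
  fixes h :: "'m::finite \<Rightarrow> nat" and s :: "'m \<Rightarrow> nat"
  assumes h: "inj h" "\<And>j. h j < CARD('m)" and s: "\<And>j. j \<in> J \<Longrightarrow> 1 \<le> s j" and "j \<in> J"
  shows "0 < (\<Prod>(j', i)\<in>(SIGMA j':J. {1..<2 * s j'}). node h j (2 * s j) - node h j' i)"
proof -
  let ?x = "node h j (2 * s j)"
  have "(\<Prod>(j', i)\<in>(SIGMA j':J. {1..<2 * s j'}). ?x - node h j' i)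
      = (\<Prod>j'\<in>J. \<Prod>i\<in>{1..<2 * s j'}. ?x - node h j' i)"
    by (subst prod.Sigma) auto
  also have "0 < \<dots>"
  proof (rule prod_pos)
    fix j' assume j': "j' \<in> J"
    have "0 < ?x - node h j' 1"
      using node_1_less[OF h, of "2 * s j" j' j] s[OF \<open>j \<in> J\<close>] by simp
    moreover have "0 < (\<Prod>r\<in>{1..<s j'}. (?x - node h j' (2 * r)) * (?x - node h j' (2 * r + 1)))"
      by (intro prod_pos node_pair_sign[OF h]) auto
    ultimately show "0 < (\<Prod>i\<in>{1..<2 * s j'}. ?x - node h j' i)"
      unfolding prod_odd_pairs[OF s[OF j']] by (rule mult_pos_pos)
  qed
  finally show ?thesis .
qed

section \<open>Limits of rescaled dependencies\<close>

lemma not_eventually_at_right_0: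
  fixes P :: "real \<Rightarrow> bool"
  assumes "\<not> (\<forall>\<^sub>F \<epsilon> in at_right 0. P \<epsilon>)"
  obtains E :: "nat \<Rightarrow> real" where "\<And>n. 0 < E n" "E \<longlonglongrightarrow> 0" "\<forall>n. \<not> P (E n)"
proof -
  have "\<forall>n. \<exists>\<epsilon>>0. \<epsilon> < inverse (real (Suc n)) \<and> \<not> P \<epsilon>"
  proof
    fix n
    have "0 < inverse (real (Suc n))" by simp
    then show "\<exists>\<epsilon>>0. \<epsilon> < inverse (real (Suc n)) \<and> \<not> P \<epsilon>"
      using assms unfolding eventually_at_right_field by blast
  qed
  then obtain E where E: "\<And>n. 0 < E n \<and> E n < inverse (real (Suc n)) \<and> \<not> P (E n)"
    by metis
  have "E \<longlonglongrightarrow> 0"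
    by (rule tendsto_sandwich[OF _ _ tendsto_const LIMSEQ_inverse_real_of_nat])
       (use E in \<open>auto intro!: always_eventually less_imp_le\<close>)
  then show ?thesis using that E by blast
qed

text \<open>Otherwise nonzero dependencies exist along a sequence tending to 0. Rescaled by blocks
  and normalized to total mass 1, they have a limit of mass 1. The bound on \<open>D\<close> leaves
  room for a polynomial of degree below \<open>D\<close> that vanishes at all low nodes. Such test
  polynomials yield the hypotheses of \<open>moment_sums_vanish\<close>, which makes the limit
  zero.\<close>

lemma eventually_no_dependency:
  fixes T S :: "'m::finite \<Rightarrow> real set" and J :: "'m set" and h :: "'m \<Rightarrow> nat"
  defines "x \<equiv> \<lambda>j i. real_of_int (node h j i)"
  assumes h: "inj h" "\<And>j. h j < CARD('m)"
    and fin: "\<And>j. j \<in> J \<Longrightarrow> finite (T j)"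
    and S: "\<And>j. j \<in> J \<Longrightarrow> S j \<subseteq> T j" "\<And>j. j \<in> J \<Longrightarrow> S j \<noteq> {}"
    and D: "(\<Sum>j\<in>J. 2 * card (S j) - 1) < D"
  shows "\<forall>\<^sub>F \<epsilon> in at_right 0. \<forall>w.
      (\<forall>j\<in>J. (\<Sum>t\<in>T j. w j t) = 0) \<longrightarrow>
      (\<forall>j\<in>J. \<forall>t\<in>T j - S j. 0 \<le> w j t) \<longrightarrow>
      (\<forall>q. degree q < D \<longrightarrow>
        (\<Sum>j\<in>J. \<Sum>t\<in>T j. w j t * (\<Sum>i=1..D. (\<epsilon> * t) ^ i * poly q (x j i))) = 0) \<longrightarrow>
      (\<forall>j\<in>J. \<forall>t\<in>T j. w j t = 0)"
    (is "eventually (\<lambda>\<epsilon>. \<forall>w. ?P1 w \<longrightarrow> ?P2 w \<longrightarrow> ?P3 \<epsilon> w \<longrightarrow> ?P4 w) _")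
proof (rule ccontr)
  assume "\<not> ?thesis"
  then obtain E where E: "\<And>n. 0 < E n" "E \<longlonglongrightarrow> 0"
    and "\<forall>n. \<not> (\<forall>w. ?P1 w \<longrightarrow> ?P2 w \<longrightarrow> ?P3 (E n) w \<longrightarrow> ?P4 w)"
    by (rule not_eventually_at_right_0) blast
  then have "\<forall>n. \<exists>w. ?P1 w \<and> ?P2 w \<and> ?P3 (E n) w \<and> \<not> ?P4 w"
    by (simp only: not_all not_imp simp_thms)
  from choice[OF this] obtain L where "\<forall>n. ?P1 (L n) \<and> ?P2 (L n) \<and> ?P3 (E n) (L n) \<and> \<not> ?P4 (L n)" ..
  note L = this[THEN spec, THEN conjunct1] this[THEN spec, THEN conjunct2, THEN conjunct1]
    this[THEN spec, THEN conjunct2, THEN conjunct2, THEN conjunct1]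
    this[THEN spec, THEN conjunct2, THEN conjunct2, THEN conjunct2]
  define s where "s j = card (S j)" for j
  have s1: "1 \<le> s j" if "j \<in> J" for j
    unfolding s_def using S(2)[OF that] finite_subset[OF S(1)[OF that] fin[OF that]]
    by (simp add: Suc_leI card_gt_0_iff)
  \<comment> \<open>Hence the node with index \<open>2 * s j\<close>, which carries the leading term
    of block \<open>j\<close>, occurs in the sum up to \<open>D\<close>.\<close>
  have sD: "2 * s j \<le> D" if "j \<in> J" for j
  proof -
    have "2 * s j - 1 \<le> (\<Sum>j\<in>J. 2 * card (S j) - 1)"
      unfolding s_def using that by (intro member_le_sum) auto
    then show ?thesis using D by simp
  qed
  define X where "X = (SIGMA j:J. T j)"
  have finX: "finite X" unfolding X_def using fin by auto
  define W where "W n = (\<Sum>(j, t)\<in>X. E n ^ (2 * s j) * \<bar>L n j t\<bar>)" for n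
  have W: "0 < W n" for n
  proof -
    obtain j t where "(j, t) \<in> X" "L n j t \<noteq> 0" using L(4)[of n] unfolding X_def by auto
    then show ?thesis
      unfolding W_def by (intro sum_pos2[OF finX, of "(j, t)"]) (use E(1)[of n] in auto)
  qed
  \<comment> \<open>The factor \<open>E n ^ (2 * s j)\<close> makes index \<open>2 * s j\<close> of
    order one in every block, so these terms stay comparable across blocks in the limit.\<close>
  define N where "N n = (\<lambda>(j, t). E n ^ (2 * s j) * L n j t / W n)" for n
  have Nsum: "(\<Sum>a\<in>X. \<bar>N n a\<bar>) = 1" for n
  proof -
    have "(\<Sum>a\<in>X. \<bar>N n a\<bar>) = (\<Sum>(j, t)\<in>X. E n ^ (2 * s j) * \<bar>L n j t\<bar>) / W n"
      unfolding N_def sum_divide_distrib using W[of n] E(1)[of n]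
      by (intro sum.cong) (auto simp: abs_mult)
    then show ?thesis using W[of n] unfolding W_def by simp
  qed
  have Nbd: "\<bar>N n a\<bar> \<le> 1" if "a \<in> X" for n a
    using member_le_sum[OF that, of "\<lambda>a. \<bar>N n a\<bar>"] finX Nsum[of n] by simp
  obtain r l where r: "strict_mono (r :: nat \<Rightarrow> nat)" and l: "\<And>a. a \<in> X \<Longrightarrow> (\<lambda>n. N (r n) a) \<longlonglongrightarrow> l a"
    using pointwise_convergent_subseq[OF finX, of N 1] Nbd by blast
  define e where "e n = E (r n)" for n
  have e0: "e \<longlonglongrightarrow> 0" unfolding e_def using LIMSEQ_subseq_LIMSEQ[OF E(2) r] by (simp add: o_def)
  have epos: "0 < e n" for n unfolding e_def by (rule E)
  define \<mu> where "\<mu> n j i = (\<Sum>t\<in>T j. N (r n) (j, t) * t ^ i)" for n j i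
  define \<nu> where "\<nu> j t = l (j, t)" for j t
  have lim_\<mu>: "(\<lambda>n. \<mu> n j i) \<longlonglongrightarrow> (\<Sum>t\<in>T j. \<nu> j t * t ^ i)" if "j \<in> J" for j i
    unfolding \<mu>_def \<nu>_def by (intro tendsto_sum tendsto_mult l tendsto_const) (auto simp: X_def that)
  \<comment> \<open>The part of the relation that has no negative powers of \<open>e n\<close>. In
    its limit only \<open>i = 2 * s j\<close> survives, where the exponent is 0.\<close>
  define G where "G q n = (\<Sum>j\<in>J. \<Sum>i\<in>{2 * s j..D}. e n ^ (i - 2 * s j) * poly q (x j i) * \<mu> n j i)" for q n
  have limG: "G q \<longlonglongrightarrow> (\<Sum>j\<in>J. poly q (x j (2 * s j)) * (\<Sum>t\<in>T j. \<nu> j t * t ^ (2 * s j)))" for q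
  proof -
    have "G q \<longlonglongrightarrow> (\<Sum>j\<in>J. \<Sum>i\<in>{2 * s j..D}. 0 ^ (i - 2 * s j) * poly q (x j i) * (\<Sum>t\<in>T j. \<nu> j t * t ^ i))"
      unfolding G_def by (intro tendsto_sum tendsto_mult tendsto_power e0 tendsto_const lim_\<mu>)
    also have "(\<Sum>j\<in>J. \<Sum>i\<in>{2 * s j..D}. 0 ^ (i - 2 * s j) * poly q (x j i) * (\<Sum>t\<in>T j. \<nu> j t * t ^ i))
        = (\<Sum>j\<in>J. poly q (x j (2 * s j)) * (\<Sum>t\<in>T j. \<nu> j t * t ^ (2 * s j)))"
    proof (rule sum.cong)
      fix j assume j: "j \<in> J"
      have "(\<Sum>i\<in>{2 * s j..D}. 0 ^ (i - 2 * s j) * poly q (x j i) * (\<Sum>t\<in>T j. \<nu> j t * t ^ i))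
          = (\<Sum>i\<in>{2 * s j}. 0 ^ (i - 2 * s j) * poly q (x j i) * (\<Sum>t\<in>T j. \<nu> j t * t ^ i))"
        by (rule sum.mono_neutral_right) (use sD[OF j] in \<open>auto simp: power_0_left\<close>)
      then show "(\<Sum>i\<in>{2 * s j..D}. 0 ^ (i - 2 * s j) * poly q (x j i) * (\<Sum>t\<in>T j. \<nu> j t * t ^ i))
          = poly q (x j (2 * s j)) * (\<Sum>t\<in>T j. \<nu> j t * t ^ (2 * s j))"
        by simp
    qed simp
    finally show ?thesis .
  qed
  have relation: "(\<Sum>j\<in>J. \<Sum>i\<in>{1..<2 * s j}. e n ^ i / e n ^ (2 * s j) * poly q (x j i) * \<mu> n j i) + G q n = 0"
    if q: "degree q < D" for q n
  proof -
    have "0 = (\<Sum>j\<in>J. \<Sum>t\<in>T j. L (r n) j t * (\<Sum>i=1..D. (e n * t) ^ i * poly q (x j i))) / W (r n)"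
      using L(3)[of "r n"] q unfolding e_def by simp
    also have "\<dots> = (\<Sum>j\<in>J. \<Sum>t\<in>T j. \<Sum>i=1..D. e n ^ i / e n ^ (2 * s j) * poly q (x j i) * (N (r n) (j, t) * t ^ i))"
      unfolding sum_divide_distrib sum_distrib_left
      using epos[of n] by (intro sum.cong refl) (simp add: N_def power_mult_distrib flip: e_def)
    also have "\<dots> = (\<Sum>j\<in>J. \<Sum>i=1..D. e n ^ i / e n ^ (2 * s j) * poly q (x j i) * \<mu> n j i)"
      unfolding \<mu>_def sum_distrib_left by (intro sum.cong refl sum.swap)
    also have "\<dots> = (\<Sum>j\<in>J. (\<Sum>i\<in>{1..<2 * s j}. e n ^ i / e n ^ (2 * s j) * poly q (x j i) * \<mu> n j i)
        + (\<Sum>i\<in>{2 * s j..D}. e n ^ (i - 2 * s j) * poly q (x j i) * \<mu> n j i))"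
    proof (rule sum.cong)
      fix j assume j: "j \<in> J"
      have "{1..D} = {1..<2 * s j} \<union> {2 * s j..D}" using s1[OF j] sD[OF j] by auto
      moreover have "(\<Sum>i\<in>{2 * s j..D}. e n ^ i / e n ^ (2 * s j) * poly q (x j i) * \<mu> n j i)
          = (\<Sum>i\<in>{2 * s j..D}. e n ^ (i - 2 * s j) * poly q (x j i) * \<mu> n j i)"
        using epos[of n] by (intro sum.cong) (auto simp: power_diff)
      ultimately show "(\<Sum>i=1..D. e n ^ i / e n ^ (2 * s j) * poly q (x j i) * \<mu> n j i)
          = (\<Sum>i\<in>{1..<2 * s j}. e n ^ i / e n ^ (2 * s j) * poly q (x j i) * \<mu> n j i)
            + (\<Sum>i\<in>{2 * s j..D}. e n ^ (i - 2 * s j) * poly q (x j i) * \<mu> n j i)"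
        by (simp add: sum.union_disjoint ivl_disj_int)
    qed simp
    finally show ?thesis unfolding G_def sum.distrib by simp
  qed
  define R where "R = (SIGMA j:J. {1..<2 * s j})"
  have R: "finite R" "card R < D"
    unfolding R_def using D s_def by (auto simp: card_SigmaI)
  define Q where "Q A = (\<Prod>(j, i)\<in>A. [:- x j i, 1:])" for A
  have degQ: "degree (Q A) < D" if "A \<subseteq> R" for A
    using degree_prod_linear(1)[of A "\<lambda>(j, i). x j i"] that R finite_subset[OF that] card_mono[OF R(1) that]
    unfolding Q_def by (simp add: case_prod_unfold)
  have Q0: "poly (Q A) (x j i) = 0" if "(j, i) \<in> A" "A \<subseteq> R" for A j i
    unfolding Q_def poly_prod using that finite_subset[OF that(2) R(1)]
    by (intro prod_zero) (auto simp: case_prod_unfold intro!: bexI[of _ "(j, i)"])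
  have low: "(\<Sum>t\<in>T j. \<nu> j t * t ^ i) = 0" if j: "j \<in> J" and i: "i < 2 * s j" for j i
  proof (cases "i = 0")
    \<comment> \<open>The curve has no constant term, so the moment of order 0 is controlled by the
      block sums of the dependency instead.\<close>
    case True
    have "\<mu> n j 0 = E (r n) ^ (2 * s j) * (\<Sum>t\<in>T j. L (r n) j t) / W (r n)" for n
      unfolding \<mu>_def N_def by (simp add: sum_distrib_left sum_divide_distrib)
    then have "(\<lambda>n. \<mu> n j 0) \<longlonglongrightarrow> 0" using L(1) j by simp
    from LIMSEQ_unique[OF lim_\<mu>[OF j] this] show ?thesis using True by simp
  next
    case False
    \<comment> \<open>\<open>Q A\<close> vanishes at every low node except \<open>x j i\<close>.
      Multiplying the relation by \<open>e n ^ (2 * s j - i)\<close> clears the negative power and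
      sends the part \<open>G\<close> to 0.\<close>
    define A where "A = R - {(j, i)}"
    have ji: "(j, i) \<in> R" unfolding R_def using j i False by auto
    have AR: "A \<subseteq> R" unfolding A_def by auto
    have nz: "poly (Q A) (x j i) \<noteq> 0"
      unfolding Q_def poly_prod using finite_subset[OF AR R(1)]
      by (auto simp: prod_zero_iff x_def node_inj[OF h] A_def)
    have "poly (Q A) (x j i) * \<mu> n j i + e n ^ (2 * s j - i) * G (Q A) n = 0" for n
    proof -
      have "(\<Sum>j'\<in>J. \<Sum>i'\<in>{1..<2 * s j'}. e n ^ i' / e n ^ (2 * s j') * poly (Q A) (x j' i') * \<mu> n j' i')
          = (\<Sum>(j', i')\<in>R. e n ^ i' / e n ^ (2 * s j') * poly (Q A) (x j' i') * \<mu> n j' i')"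
        unfolding R_def by (subst sum.Sigma) auto
      also have "\<dots> = (\<Sum>(j', i')\<in>{(j, i)}. e n ^ i' / e n ^ (2 * s j') * poly (Q A) (x j' i') * \<mu> n j' i')"
      proof (rule sum.mono_neutral_right)
        show "\<forall>a\<in>R - {(j, i)}. (case a of (j', i') \<Rightarrow> e n ^ i' / e n ^ (2 * s j') * poly (Q A) (x j' i') * \<mu> n j' i') = 0"
          using Q0[OF _ AR] unfolding A_def by fastforce
      qed (use R ji in auto)
      finally have "e n ^ i / e n ^ (2 * s j) * (poly (Q A) (x j i) * \<mu> n j i) + G (Q A) n = 0"
        using relation[OF degQ[OF AR], of n] by (simp add: mult.assoc)
      moreover have "e n ^ i / e n ^ (2 * s j) = 1 / e n ^ (2 * s j - i)"
        using i epos[of n] by (simp add: power_diff)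
      ultimately have "1 / e n ^ (2 * s j - i) * (poly (Q A) (x j i) * \<mu> n j i) + G (Q A) n = 0"
        by (simp only:)
      then show ?thesis
        using epos[of n] by (simp add: field_simps)
    qed
    moreover have "(\<lambda>n. poly (Q A) (x j i) * \<mu> n j i + e n ^ (2 * s j - i) * G (Q A) n)
        \<longlonglongrightarrow> poly (Q A) (x j i) * (\<Sum>t\<in>T j. \<nu> j t * t ^ i)
          + 0 ^ (2 * s j - i) * (\<Sum>j\<in>J. poly (Q A) (x j (2 * s j)) * (\<Sum>t\<in>T j. \<nu> j t * t ^ (2 * s j)))"
      by (intro tendsto_intros e0 lim_\<mu>[OF j] limG)
    ultimately have "poly (Q A) (x j i) * (\<Sum>t\<in>T j. \<nu> j t * t ^ i) = 0"
      using i by (simp add: LIMSEQ_const_iff power_0_left)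
    then show ?thesis using nz by simp
  qed
  \<comment> \<open>\<open>Q R\<close> vanishes at all low nodes, so the relation reduces to
    \<open>G\<close> and its limit links the top moments. Its values at the top nodes, positive by
    the placement of the nodes, serve as the \<open>\<kappa> j\<close>.\<close>
  have top: "(\<Sum>j\<in>J. poly (Q R) (x j (2 * s j)) * (\<Sum>t\<in>T j. \<nu> j t * t ^ (2 * s j))) = 0"
  proof -
    have "G (Q R) n = 0" for n
    proof -
      have "(\<Sum>j\<in>J. \<Sum>i\<in>{1..<2 * s j}. e n ^ i / e n ^ (2 * s j) * poly (Q R) (x j i) * \<mu> n j i) = 0"
        using Q0[of _ _ R] by (intro sum.neutral ballI) (auto simp: R_def)
      then show ?thesis using relation[OF degQ[of R], of n] by simp
    qed
    then have "G (Q R) = (\<lambda>n. 0)" by auto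
    then have "G (Q R) \<longlonglongrightarrow> 0" by simp
    from LIMSEQ_unique[OF limG this] show ?thesis .
  qed
  have "\<nu> j t = 0" if "j \<in> J" "t \<in> T j" for j t
  proof (rule moment_sums_vanish[where \<nu> = \<nu> and J = J and T = T and S = S and \<kappa> = "\<lambda>j. poly (Q R) (x j (2 * s j))"])
    show "0 \<le> \<nu> j t" if "j \<in> J" "t \<in> T j - S j" for j t
    proof -
      have "0 \<le> N (r n) (j, t)" for n
        unfolding N_def using L(2)[of "r n"] W[of "r n"] E(1)[of "r n"] that by simp
      then show ?thesis
        unfolding \<nu>_def using that l[of "(j, t)"] by (intro LIMSEQ_le_const) (auto simp: X_def)
    qed
    show "0 < poly (Q R) (x j (2 * s j))" if "j \<in> J" for j
    proof -
      have "poly (Q R) (x j (2 * s j)) = real_of_int (\<Prod>(j', i)\<in>R. node h j (2 * s j) - node h j' i)"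
        unfolding Q_def poly_prod x_def by (simp add: case_prod_unfold)
      moreover have "0 < (\<Prod>(j', i)\<in>R. node h j (2 * s j) - node h j' i)"
        unfolding R_def by (rule prod_node_pos[OF h]) (use s1 that in auto)
      ultimately show ?thesis by (simp only: of_int_0_less_iff)
    qed
  qed (use that fin S low top in \<open>auto simp: s_def\<close>)
  then have "(\<Sum>a\<in>X. \<bar>l a\<bar>) = 0" unfolding X_def \<nu>_def by (intro sum.neutral) auto
  moreover have "(\<lambda>n. \<Sum>a\<in>X. \<bar>N (r n) a\<bar>) \<longlonglongrightarrow> (\<Sum>a\<in>X. \<bar>l a\<bar>)"
    by (intro tendsto_sum tendsto_rabs l)
  ultimately show False using Nsum by (simp add: LIMSEQ_const_iff)
qed

section \<open>From absent dependencies to neighborly polytopes\<close>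

lemma no_dependency_singleton_inj:
  assumes nd: "no_dependency {j} T (\<lambda>_. {t}) v" and "finite (T j)" "t \<in> T j" "t' \<in> T j" "v j t = v j t'"
  shows "t = t'"
proof (rule ccontr)
  assume "t \<noteq> t'"
  \<comment> \<open>If \<open>t\<close> and \<open>t'\<close> had the same image, weight 1 at
    \<open>t'\<close> and -1 at \<open>t\<close> would be a dependency, negative only at
    \<open>t\<close>.\<close>
  define w where "w = (\<lambda>(_ :: 'a) s. (if s = t' then 1 else 0) - (if s = t then 1 else 0 :: real))"
  have "(\<Sum>s\<in>T j. w j s) = 0"
    using assms(2-4) by (simp add: w_def sum_subtractf)
  moreover have "(\<Sum>s\<in>T j. w j s *\<^sub>R v j s) = 0"
    using assms(2-5) by (simp add: w_def sum_subtractf scaleR_left_diff_distrib if_distrib[where f = "\<lambda>x. x *\<^sub>R _"] cong: if_cong)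
  moreover have "\<forall>s\<in>T j - {t}. 0 \<le> w j s" by (simp add: w_def)
  ultimately have "w j t' = 0"
    using nd \<open>t' \<in> T j\<close> unfolding no_dependency_def by simp
  then show False using \<open>t \<noteq> t'\<close> by (simp add: w_def)
qed

lemma verts_convex_hull_eq:
  fixes X :: "'m \<Rightarrow> 'a::real_vector set"
  assumes "finite (X j)" and nd: "\<And>x. x \<in> X j \<Longrightarrow> no_dependency {j} X (\<lambda>_. {x}) (\<lambda>_ x. x)"
  shows "verts (convex hull (X j)) = X j"
proof
  show "verts (convex hull (X j)) \<subseteq> X j"
    unfolding verts_def using extreme_point_of_convex_hull by blast
  show "X j \<subseteq> verts (convex hull (X j))"
  proof
    fix x assume x: "x \<in> X j"
    have "{x} face_of convex hull (X j)"
      using face_of_sum_convex_hull[of "{j}" X "\<lambda>_. {x}"] nd[OF x] x assms(1) by simp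
    then show "x \<in> verts (convex hull (X j))"
      unfolding verts_def by (simp add: face_of_singleton)
  qed
qed

text \<open>\<open>idx\<close> enumerates the exponents below \<open>CARD('d)\<close>, as
  coordinates are indexed by an unordered type. Pairing with the coefficients of \<open>q\<close>
  replaces \<open>x i ^ idx a\<close> by \<open>poly q (x i)\<close>.\<close>

definition moment_point :: "('d::finite \<Rightarrow> nat) \<Rightarrow> real \<Rightarrow> (nat \<Rightarrow> real) \<Rightarrow> real \<Rightarrow> real^'d" where
  "moment_point idx \<epsilon> x t = (\<chi> a. \<Sum>i=1..CARD('d). (\<epsilon> * t) ^ i * x i ^ idx a)"

lemma moment_point_orthogonal_poly:
  fixes w :: "'m \<Rightarrow> real \<Rightarrow> real" and idx :: "'d::finite \<Rightarrow> nat"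
  assumes idx: "bij_betw idx UNIV {0..<CARD('d)}"
    and sum0: "(\<Sum>j\<in>J. \<Sum>t\<in>T j. w j t *\<^sub>R moment_point idx \<epsilon> (x j) t) = 0"
    and q: "degree q < CARD('d)"
  shows "(\<Sum>j\<in>J. \<Sum>t\<in>T j. w j t * (\<Sum>i=1..CARD('d). (\<epsilon> * t) ^ i * poly q (x j i))) = 0"
proof -
  let ?D = "CARD('d)"
  have comp: "(\<Sum>j\<in>J. \<Sum>t\<in>T j. w j t * (\<Sum>i=1..?D. (\<epsilon> * t) ^ i * x j i ^ k)) = 0" if "k < ?D" for k
  proof -
    have "k \<in> range idx" using bij_betw_imp_surj_on[OF idx] that by simp
    then obtain a where a: "idx a = k" by blast
    have "(\<Sum>j\<in>J. \<Sum>t\<in>T j. w j t *\<^sub>R moment_point idx \<epsilon> (x j) t) $ a = 0" using sum0 by simp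
    then show ?thesis using a by (simp add: moment_point_def)
  qed
  have q_eq: "poly q y = (\<Sum>k<?D. coeff q k * y ^ k)" for y
    unfolding poly_altdef using q by (intro sum.mono_neutral_left) (auto simp: coeff_eq_0)
  have "w j t * (\<Sum>i=1..?D. (\<epsilon> * t) ^ i * poly q (x j i))
      = (\<Sum>k<?D. coeff q k * (w j t * (\<Sum>i=1..?D. (\<epsilon> * t) ^ i * x j i ^ k)))" for j t
    unfolding q_eq sum_distrib_left by (subst sum.swap) (simp add: mult_ac)
  then have "(\<Sum>j\<in>J. \<Sum>t\<in>T j. w j t * (\<Sum>i=1..?D. (\<epsilon> * t) ^ i * poly q (x j i)))
      = (\<Sum>j\<in>J. \<Sum>t\<in>T j. \<Sum>k<?D. coeff q k * (w j t * (\<Sum>i=1..?D. (\<epsilon> * t) ^ i * x j i ^ k)))"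
    by simp
  also have "\<dots> = (\<Sum>j\<in>J. \<Sum>k<?D. \<Sum>t\<in>T j. coeff q k * (w j t * (\<Sum>i=1..?D. (\<epsilon> * t) ^ i * x j i ^ k)))"
    by (intro sum.cong refl sum.swap)
  also have "\<dots> = (\<Sum>k<?D. \<Sum>j\<in>J. \<Sum>t\<in>T j. coeff q k * (w j t * (\<Sum>i=1..?D. (\<epsilon> * t) ^ i * x j i ^ k)))"
    by (rule sum.swap)
  also have "\<dots> = (\<Sum>k<?D. coeff q k * (\<Sum>j\<in>J. \<Sum>t\<in>T j. w j t * (\<Sum>i=1..?D. (\<epsilon> * t) ^ i * x j i ^ k)))"
    by (simp only: sum_distrib_left)
  also have "\<dots> = 0" using comp by simp
  finally show ?thesis .
qed

text \<open>Each choice of \<open>J\<close> and \<open>S\<close> admits all sufficiently small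
  positive \<open>\<epsilon>\<close>. There are finitely many choices, so one
  \<open>\<epsilon>\<close> serves them all.\<close>

lemma exists_no_dependency_points:
  fixes T :: "'m::finite \<Rightarrow> real set"
  assumes fin: "\<And>j. finite (T j)"
  obtains v :: "'m \<Rightarrow> real \<Rightarrow> real^'d::finite"
  where "\<And>J S. (\<And>j. j \<in> J \<Longrightarrow> S j \<subseteq> T j \<and> S j \<noteq> {}) \<Longrightarrow> (\<Sum>j\<in>J. 2 * card (S j) - 1) < CARD('d) \<Longrightarrow>
    no_dependency J T S v"
proof -
  obtain idx :: "'d \<Rightarrow> nat" where idx: "bij_betw idx UNIV {0..<CARD('d)}"
    using ex_bij_betw_finite_nat[of "UNIV :: 'd set"] by auto
  obtain h :: "'m \<Rightarrow> nat" where "bij_betw h UNIV {0..<CARD('m)}"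
    using ex_bij_betw_finite_nat[of "UNIV :: 'm set"] by auto
  then have h: "inj h" "\<And>j. h j < CARD('m)" unfolding bij_betw_def by auto
  define v where "v \<epsilon> j = moment_point idx \<epsilon> (\<lambda>i. real_of_int (node h j i))" for \<epsilon> j
  define F where "F = {(J, S). S \<in> PiE UNIV (\<lambda>j. Pow (T j)) \<and> (\<forall>j\<in>J. S j \<noteq> {})
    \<and> (\<Sum>j\<in>J. 2 * card (S j) - 1) < CARD('d)}"
  have "finite ((UNIV :: 'm set set) \<times> PiE UNIV (\<lambda>j. Pow (T j)))"
    using fin by (intro finite_cartesian_product finite_PiE) auto
  then have "finite F" by (rule rev_finite_subset) (auto simp: F_def)
  moreover have "\<forall>p\<in>F. \<forall>\<^sub>F \<epsilon> in at_right 0. no_dependency (fst p) T (snd p) (v \<epsilon>)"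
  proof
    fix p assume "p \<in> F"
    then obtain J S where p: "p = (J, S)" and S: "\<And>j. S j \<subseteq> T j" "\<And>j. j \<in> J \<Longrightarrow> S j \<noteq> {}"
      "(\<Sum>j\<in>J. 2 * card (S j) - 1) < CARD('d)"
      unfolding F_def by (auto simp: PiE_iff)
    have "\<forall>\<^sub>F \<epsilon> in at_right 0. no_dependency J T S (v \<epsilon>)"
    proof (rule eventually_mono[OF eventually_no_dependency[OF h, of J T S "CARD('d)"]], goal_cases)
      case (5 \<epsilon>)
      show ?case
        unfolding no_dependency_def
      proof (intro allI impI)
        fix w assume w: "\<forall>j\<in>J. (\<Sum>t\<in>T j. w j t) = 0" "\<forall>j\<in>J. \<forall>t\<in>T j - S j. 0 \<le> w j t"
          "(\<Sum>j\<in>J. \<Sum>t\<in>T j. w j t *\<^sub>R v \<epsilon> j t) = 0"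
        show "\<forall>j\<in>J. \<forall>t\<in>T j. w j t = 0"
          using 5[rule_format, of w] w(1,2) moment_point_orthogonal_poly[OF idx w(3)[unfolded v_def]] by blast
      qed
    qed (use fin S in auto)
    then show "\<forall>\<^sub>F \<epsilon> in at_right 0. no_dependency (fst p) T (snd p) (v \<epsilon>)" unfolding p by simp
  qed
  ultimately have "\<forall>\<^sub>F \<epsilon> in at_right 0. \<forall>p\<in>F. no_dependency (fst p) T (snd p) (v \<epsilon>)"
    by (rule eventually_ball_finite)
  then obtain \<epsilon> where \<epsilon>: "\<forall>p\<in>F. no_dependency (fst p) T (snd p) (v \<epsilon>)"
    using eventually_happens'[OF trivial_limit_at_right_real] by blast
  show ?thesis
  proof (rule that)
    fix J and S :: "'m \<Rightarrow> real set"
    assume S: "\<And>j. j \<in> J \<Longrightarrow> S j \<subseteq> T j \<and> S j \<noteq> {}" "(\<Sum>j\<in>J. 2 * card (S j) - 1) < CARD('d)"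
    \<comment> \<open>The values of \<open>S\<close> outside \<open>J\<close> are arbitrary.
      Resetting them puts the pair into the finite family \<open>F\<close>.\<close>
    define S' where "S' j = (if j \<in> J then S j else {})" for j
    have "(J, S') \<in> F" unfolding F_def S'_def using S by (auto simp: PiE_iff)
    then have "no_dependency J T S' (v \<epsilon>)" using \<epsilon> by force
    then show "no_dependency J T S (v \<epsilon>)" unfolding no_dependency_def S'_def by simp
  qed
qed

text \<open>For \<open>CARD('d) > 1\<close> the bound admits a single vertex in a single block,
  which gives injectivity of the parametrization and shows that every point is a vertex. For
  \<open>CARD('d) = 1\<close> it admits only empty \<open>J\<close>, and segments serve.\<close>

lemma exists_neighborly_points:
  fixes n :: "'m::finite \<Rightarrow> nat"
  assumes n: "CARD('d) = 1 \<Longrightarrow> \<forall>i. n i = 2"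
  obtains X :: "'m \<Rightarrow> (real^'d::finite) set"
  where "\<And>i. finite (X i)" "\<And>i. card (X i) = n i" "\<And>i. verts (convex hull (X i)) = X i"
    "\<And>J S. (\<And>j. j \<in> J \<Longrightarrow> S j \<subseteq> X j \<and> S j \<noteq> {}) \<Longrightarrow> (\<Sum>j\<in>J. 2 * card (S j) - 1) < CARD('d) \<Longrightarrow>
      no_dependency J X S (\<lambda>_ x. x)"
proof (cases "CARD('d) = 1")
  case True
  define X :: "'m \<Rightarrow> (real^'d) set" where "X i = {0, 1}" for i
  show ?thesis
  proof (rule that)
    show "finite (X i)" "card (X i) = n i" "verts (convex hull (X i)) = X i" for i
      using n[OF True] by (auto simp: X_def verts_def extreme_point_of_convex_hull_2)
    fix J and S :: "'m \<Rightarrow> (real^'d) set"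
    assume S: "\<And>j. j \<in> J \<Longrightarrow> S j \<subseteq> X j \<and> S j \<noteq> {}" "(\<Sum>j\<in>J. 2 * card (S j) - 1) < CARD('d)"
    have "0 < card (S j)" if "j \<in> J" for j
      using S(1)[OF that] finite_subset[of "S j" "X j"] by (simp add: X_def card_gt_0_iff)
    then have "J = {}" using S(2) True by fastforce
    then show "no_dependency J X S (\<lambda>_ x. x)" by (simp add: no_dependency_def)
  qed
next
  case False
  then have d: "1 < CARD('d)" using zero_less_card_finite[where 'a = 'd] by linarith
  define T where "T i = real ` {..<n i}" for i
  have T: "finite (T i)" "card (T i) = n i" for i
    unfolding T_def by (auto simp: card_image)
  obtain v :: "'m \<Rightarrow> real \<Rightarrow> real^'d" where v: "\<And>J S. (\<And>j. j \<in> J \<Longrightarrow> S j \<subseteq> T j \<and> S j \<noteq> {}) \<Longrightarrow>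
      (\<Sum>j\<in>J. 2 * card (S j) - 1) < CARD('d) \<Longrightarrow> no_dependency J T S v"
    using exists_no_dependency_points[of T] T(1) by blast
  have inj: "inj_on (v j) (T j)" for j
  proof (rule inj_onI)
    fix t t' assume t: "t \<in> T j" "t' \<in> T j" "v j t = v j t'"
    have "no_dependency {j} T (\<lambda>_. {t}) v" by (rule v) (use t d in auto)
    then show "t = t'" using no_dependency_singleton_inj[of j T t v t'] t T by blast
  qed
  define X where "X j = v j ` T j" for j
  have nd: "no_dependency J X S (\<lambda>_ x. x)"
    if S: "\<And>j. j \<in> J \<Longrightarrow> S j \<subseteq> X j \<and> S j \<noteq> {}" and card: "(\<Sum>j\<in>J. 2 * card (S j) - 1) < CARD('d)" for J S
  proof -
    define S' where "S' j = {t \<in> T j. v j t \<in> S j}" for j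
    have S': "v j ` S' j = S j" if "j \<in> J" for j
      using S[OF that] unfolding S'_def X_def by auto
    have sub: "S' j \<subseteq> T j" for j unfolding S'_def by auto
    have "card (S' j) = card (S j)" if "j \<in> J" for j
      using S'[OF that] card_image[OF inj_on_subset[OF inj sub]] by metis
    then have "(\<Sum>j\<in>J. 2 * card (S' j) - 1) < CARD('d)" using card by simp
    moreover have "S' j \<noteq> {}" if "j \<in> J" for j using S[OF that] S'[OF that] by auto
    ultimately have "no_dependency J T S' v" using v[of J S'] sub by blast
    then have "no_dependency J X (\<lambda>j. v j ` S' j) (\<lambda>_ x. x)"
      unfolding X_def by (intro no_dependency_image inj sub)
    then show ?thesis unfolding no_dependency_def using S' by simp
  qed
  show ?thesis
  proof (rule that)
    show finX: "finite (X j)" and "card (X j) = n j" for j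
      unfolding X_def using T inj by (auto simp: card_image)
    show "verts (convex hull (X j)) = X j" for j
      by (intro verts_convex_hull_eq finX nd) (use d in auto)
  qed (fact nd)
qed

lemma neighborly_convex_hulls:
  fixes X :: "'m::finite \<Rightarrow> (real^'d::finite) set"
  assumes X: "\<And>i. finite (X i)" "\<And>i. verts (convex hull (X i)) = X i"
    and nd: "\<And>J S. (\<And>j. j \<in> J \<Longrightarrow> S j \<subseteq> X j \<and> S j \<noteq> {}) \<Longrightarrow> (\<Sum>j\<in>J. 2 * card (S j) - 1) < CARD('d) \<Longrightarrow>
      no_dependency J X S (\<lambda>_ x. x)"
    and kl: "2 * k + l \<le> CARD('d) + 1"
  shows "minkowski_neighborly k l (\<lambda>i. convex hull (X i))"
  unfolding minkowski_neighborly_def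
proof (intro allI impI)
  fix J :: "'m set" and S :: "'m \<Rightarrow> (real^'d) set"
  assume J: "card J = l" and "\<forall>j\<in>J. S j \<noteq> {} \<and> S j \<subseteq> verts (convex hull (X j))"
    and card: "int (\<Sum>j\<in>J. card (S j)) \<le> int k + int (card J) - 1"
  then have S: "S j \<subseteq> X j \<and> S j \<noteq> {}" if "j \<in> J" for j using that X(2) by auto
  have pos: "0 < card (S j)" if "j \<in> J" for j
    using S[OF that] X(1)[of j] finite_subset by (auto simp: card_gt_0_iff)
  \<comment> \<open>Adding \<open>card J\<close> undoes the natural subtractions. The sum is then at
    most \<open>2 * (k + l - 1) - l\<close>, which is below \<open>CARD('d)\<close> by
    \<open>kl\<close>.\<close>
  have "(\<Sum>j\<in>J. 2 * card (S j) - 1) + card J = (\<Sum>j\<in>J. 2 * card (S j) - 1 + 1)"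
    by (simp only: sum.distrib) simp
  also have "\<dots> = (\<Sum>j\<in>J. 2 * card (S j))"
    by (intro sum.cong) (use pos in force)+
  also have "\<dots> = 2 * (\<Sum>j\<in>J. card (S j))" by (simp add: sum_distrib_left)
  finally have "(\<Sum>j\<in>J. 2 * card (S j) - 1) < CARD('d)"
    using card kl J by linarith
  then have "no_dependency J X S (\<lambda>_ x. x)" using nd S by blast
  then show "(\<Sum>j\<in>J. convex hull (S j)) face_of (\<Sum>j\<in>J. convex hull (X j)) \<and>
      (int (\<Sum>j\<in>J. card (S j)) - 1) simplex (cayley J S)"
    using S X(1) by (intro conjI face_of_sum_convex_hull simplex_cayley) auto
qed

text \<open>The two halves meet at complementary thresholds,
  \<open>CARD('d) + 2 \<le> 2 * k + l\<close> and \<open>2 * k + l \<le> CARD('d) + 1\<close>. The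
  side conditions exclude degenerate cases: for \<open>k = 0\<close> and \<open>1 \<le> l\<close> no
  admissible \<open>S\<close> exists, every vertex set of a simplex spans a face, and a polytope on
  a line has at most two vertices.\<close>

theorem theorem5p2:
  shows
    "\<not> (\<exists>(P :: 'm::finite \<Rightarrow> (real^'d::finite) set) (k::nat) (l::nat).
          (\<forall>i. polytope (P i)) \<and> pure_family P \<and>
          1 \<le> l \<and> l \<le> CARD('m) \<and> 1 \<le> k \<and>
          \<not> (l = 1 \<and> (\<forall>i. int CARD('d) simplex (P i))) \<and>
          minkowski_neighborly k l P \<and>
          real k + real l - 1 > (real CARD('d) + real l - 1) / 2)
     \<and>
     (\<forall>n :: 'm \<Rightarrow> nat. (\<forall>i. n i \<ge> CARD('d) + 1) \<longrightarrow> (CARD('d) = 1 \<longrightarrow> (\<forall>i. n i = 2)) \<longrightarrow>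
        (\<exists>P :: 'm \<Rightarrow> (real^'d) set.
           (\<forall>i. polytope (P i)) \<and> (\<forall>i. f0 (P i) = n i) \<and>
           (\<forall>(l::nat) (k::nat).
              l \<le> CARD('m) \<longrightarrow>
              int l - 1 \<le> int k + int l - 1 \<longrightarrow>
              int k + int l - 1 \<le> \<lfloor>(real CARD('d) + real l - 1) / 2\<rfloor> \<longrightarrow>
              minkowski_neighborly k l P)))"
proof (intro conjI notI allI impI)
  assume "\<exists>(P :: 'm \<Rightarrow> (real^'d) set) (k::nat) (l::nat).
          (\<forall>i. polytope (P i)) \<and> pure_family P \<and>
          1 \<le> l \<and> l \<le> CARD('m) \<and> 1 \<le> k \<and>
          \<not> (l = 1 \<and> (\<forall>i. int CARD('d) simplex (P i))) \<and>
          minkowski_neighborly k l P \<and>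
          real k + real l - 1 > (real CARD('d) + real l - 1) / 2"
  then obtain P :: "'m \<Rightarrow> (real^'d) set" and k l where P: "\<forall>i. polytope (P i)" "pure_family P"
      "1 \<le> l" "l \<le> CARD('m)" "1 \<le> k" "\<not> (l = 1 \<and> (\<forall>i. int CARD('d) simplex (P i)))"
      "minkowski_neighborly k l P" "real k + real l - 1 > (real CARD('d) + real l - 1) / 2"
    by (elim exE conjE)
  have "real CARD('d) + 1 < real (2 * k + l)" using P(8) by (simp add: field_simps)
  then have "CARD('d) + 2 \<le> 2 * k + l" by linarith
  then show False using not_neighborly[of P l k] P by blast
next
  fix n :: "'m \<Rightarrow> nat"
  assume "CARD('d) = 1 \<longrightarrow> (\<forall>i. n i = 2)"
  then obtain X :: "'m \<Rightarrow> (real^'d) set" where X: "\<And>i. finite (X i)" "\<And>i. card (X i) = n i"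
    "\<And>i. verts (convex hull (X i)) = X i"
    "\<And>J S. (\<And>j. j \<in> J \<Longrightarrow> S j \<subseteq> X j \<and> S j \<noteq> {}) \<Longrightarrow> (\<Sum>j\<in>J. 2 * card (S j) - 1) < CARD('d) \<Longrightarrow>
      no_dependency J X S (\<lambda>_ x. x)"
    using exists_neighborly_points[where 'd = 'd, of n] by blast
  show "\<exists>P :: 'm \<Rightarrow> (real^'d) set. (\<forall>i. polytope (P i)) \<and> (\<forall>i. f0 (P i) = n i) \<and>
           (\<forall>(l::nat) (k::nat).
              l \<le> CARD('m) \<longrightarrow>
              int l - 1 \<le> int k + int l - 1 \<longrightarrow>
              int k + int l - 1 \<le> \<lfloor>(real CARD('d) + real l - 1) / 2\<rfloor> \<longrightarrow>
              minkowski_neighborly k l P)"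
  proof (intro exI[of _ "\<lambda>i. convex hull (X i)"] conjI allI impI)
    show "polytope (convex hull (X i))" "f0 (convex hull (X i)) = n i" for i
      using X(1-3) by (auto simp: polytope_def f0_def)
    fix l k :: nat
    assume "int k + int l - 1 \<le> \<lfloor>(real CARD('d) + real l - 1) / 2\<rfloor>"
    then have "2 * k + l \<le> CARD('d) + 1" by (simp add: le_floor_iff)
    then show "minkowski_neighborly k l (\<lambda>i. convex hull (X i))"
      by (intro neighborly_convex_hulls X)
  qed
qed


end
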